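(* Let $S$ be a finite regular semigroup. Then $S$ is an inverse semigroup if and only if, for each $\mathcal{J}$-class of $S$, there exists a pair of matrix Schützenberger representations of $S$ associated to that $\mathcal{J}$-class which are both semiunitary.
   Context: For a finite semigroup $S$, $S^1$ is $S$ with an identity adjoined if necessary, $E(S)$ the set of idempotents; $L_e=\{x:S^1x=S^1e\}$, $R_e=\{x:xS^1=eS^1\}$, $J_e=\{x:S^1xS^1=S^1eS^1\}$, and $G_e=L_e\cap R_e$ (a group). $S$ is regular if every element $a$ has some $b$ with $aba=a$; then every $\mathcal{J}$-class contains an idempotent. $S$ is inverse if each $a$ has a unique $b$ with $aba=a$, $bab=b$. Matrix Schützenberger representations: pick an idempotent $e$ in the $\mathcal{J}$-class, representatives $x_1,\dots,x_s\in L_e$ and $y_1,\dots,y_t\in R_e$ with $L_e=\bigsqcup_i x_iG_e$, $R_e=\bigsqcup_j G_ey_j$, and let $\sigma=\sigma_1\oplus\cdots\oplus\sigma_r$ where $\sigma_1,\dots,\sigma_r$ is a complete set of pairwise inequivalent irreducible matrix representations of $G_e$, extended by $\sigma(0)=0$. For $u\in S$: if $ux_i\in L_e$ write $ux_i=x_jg_{ji}$ with $g_{ji}\in G_e$ (unique), other entries of the $s\times s$ matrix $(g_{ji})$ being $0$; set $\mathrm{Ind}_{G_e}(\sigma)(u)=(\sigma(g_{ji}))$ (block matrix). If $y_ju\in R_e$ write $y_ju=h_{ji}y_i$ with $h_{ji}\in G_e$ (unique), other entries $0$; set $\mathrm{Coind}_{G_e}(\sigma)(u)=(\sigma(h_{ji}))$.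 The pair $(\mathrm{Ind}_{G_e}(\sigma),\mathrm{Coind}_{G_e}(\sigma))$ (for some such choices) is a pair of matrix Schützenberger representations associated to the $\mathcal{J}$-class. A matrix representation $\rho$ is semiunitary if $\rho(u)\rho(u)^*\rho(u)=\rho(u)$ for all $u\in S$ ($^*$ = conjugate transpose). *)

theory Defs
  imports "Jordan_Normal_Form.Schur_Decomposition"
begin

text \<open>A finite semigroup is modelled as a type of class finite and semigroup_mult;
  the semigroup is the universe of the type.  S^1 is handled by inserting x itself.\<close>

definition left_ideal1 :: "'a::semigroup_mult \<Rightarrow> 'a set" where
  "left_ideal1 x = insert x (range (\<lambda>s. s * x))"

definition right_ideal1 :: "'a::semigroup_mult \<Rightarrow> 'a set" where
  "right_ideal1 x = insert x (range (\<lambda>t. x * t))"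

definition two_ideal1 :: "'a::semigroup_mult \<Rightarrow> 'a set" where
  "two_ideal1 x = insert x (range (\<lambda>s. s * x) \<union> range (\<lambda>t. x * t) \<union> range (\<lambda>(s, t). s * x * t))"

definition Lclass :: "'a::semigroup_mult \<Rightarrow> 'a set" where
  "Lclass e = {x. left_ideal1 x = left_ideal1 e}"

definition Rclass :: "'a::semigroup_mult \<Rightarrow> 'a set" where
  "Rclass e = {x. right_ideal1 x = right_ideal1 e}"

definition Jclass :: "'a::semigroup_mult \<Rightarrow> 'a set" where
  "Jclass e = {x. two_ideal1 x = two_ideal1 e}"

definition Hgroup :: "'a::semigroup_mult \<Rightarrow> 'a set" where
  "Hgroup e = Lclass e \<inter> Rclass e"

definition idempotent :: "'a::semigroup_mult \<Rightarrow> bool" where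
  "idempotent e \<longleftrightarrow> e * e = e"

definition regular_semigroup :: "'a::semigroup_mult itself \<Rightarrow> bool" where
  "regular_semigroup _ \<longleftrightarrow> (\<forall>a::'a. \<exists>b. a * b * a = a)"

definition inverse_semigroup :: "'a::semigroup_mult itself \<Rightarrow> bool" where
  "inverse_semigroup _ \<longleftrightarrow> (\<forall>a::'a. \<exists>!b. a * b * a = a \<and> b * a * b = b)"

definition is_mat_rep :: "'a::semigroup_mult \<Rightarrow> nat \<Rightarrow> ('a \<Rightarrow> complex mat) \<Rightarrow> bool" where
  "is_mat_rep e d \<rho> \<longleftrightarrow>
     (\<forall>g\<in>Hgroup e. \<rho> g \<in> carrier_mat d d) \<and>
     (\<forall>g\<in>Hgroup e. \<forall>h\<in>Hgroup e. \<rho> (g * h) = \<rho> g * \<rho> h) \<and>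
     \<rho> e = 1\<^sub>m d"

definition is_subspace :: "nat \<Rightarrow> complex vec set \<Rightarrow> bool" where
  "is_subspace d W \<longleftrightarrow> W \<subseteq> carrier_vec d \<and> 0\<^sub>v d \<in> W \<and>
     (\<forall>v\<in>W. \<forall>w\<in>W. v + w \<in> W) \<and> (\<forall>c. \<forall>v\<in>W. c \<cdot>\<^sub>v v \<in> W)"

definition irreducible_rep :: "'a::semigroup_mult \<Rightarrow> nat \<Rightarrow> ('a \<Rightarrow> complex mat) \<Rightarrow> bool" where
  "irreducible_rep e d \<rho> \<longleftrightarrow> is_mat_rep e d \<rho> \<and> d > 0 \<and>
     (\<forall>W. is_subspace d W \<and> (\<forall>g\<in>Hgroup e. \<forall>w\<in>W. \<rho> g *\<^sub>v w \<in> W)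
          \<longrightarrow> W = {0\<^sub>v d} \<or> W = carrier_vec d)"

definition equiv_rep :: "'a::semigroup_mult \<Rightarrow> nat \<Rightarrow> ('a \<Rightarrow> complex mat) \<Rightarrow> nat \<Rightarrow> ('a \<Rightarrow> complex mat) \<Rightarrow> bool" where
  "equiv_rep e d \<rho> d' \<rho>' \<longleftrightarrow> d = d' \<and>
     (\<exists>P \<in> carrier_mat d d. invertible_mat P \<and> (\<forall>g\<in>Hgroup e. P * \<rho> g = \<rho>' g * P))"

definition complete_irreps :: "'a::semigroup_mult \<Rightarrow> (('a \<Rightarrow> complex mat) \<times> nat) list \<Rightarrow> bool" where
  "complete_irreps e \<sigma>s \<longleftrightarrow>
     (\<forall>k<length \<sigma>s. irreducible_rep e (snd (\<sigma>s ! k)) (fst (\<sigma>s ! k))) \<and>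
     (\<forall>k<length \<sigma>s. \<forall>l<length \<sigma>s. k \<noteq> l \<longrightarrow>
        \<not> equiv_rep e (snd (\<sigma>s ! k)) (fst (\<sigma>s ! k)) (snd (\<sigma>s ! l)) (fst (\<sigma>s ! l))) \<and>
     (\<forall>d \<rho>. irreducible_rep e d \<rho> \<longrightarrow>
        (\<exists>k<length \<sigma>s. equiv_rep e d \<rho> (snd (\<sigma>s ! k)) (fst (\<sigma>s ! k))))"

fun dsum_rep :: "(('a \<Rightarrow> complex mat) \<times> nat) list \<Rightarrow> 'a \<Rightarrow> complex mat" where
  "dsum_rep [] g = 0\<^sub>m 0 0"
| "dsum_rep ((\<rho>, d) # rs) g =
     four_block_mat (\<rho> g) (0\<^sub>m d (sum_list (map snd rs)))
                    (0\<^sub>m (sum_list (map snd rs)) d) (dsum_rep rs g)"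

definition dsum_dim :: "(('a \<Rightarrow> complex mat) \<times> nat) list \<Rightarrow> nat" where
  "dsum_dim \<sigma>s = sum_list (map snd \<sigma>s)"

definition L_reps :: "'a::semigroup_mult \<Rightarrow> 'a list \<Rightarrow> bool" where
  "L_reps e xs \<longleftrightarrow> set xs \<subseteq> Lclass e \<and>
     Lclass e = (\<Union>i<length xs. (\<lambda>g. xs ! i * g) ` Hgroup e) \<and>
     (\<forall>i<length xs. \<forall>j<length xs. i \<noteq> j \<longrightarrow>
        (\<lambda>g. xs ! i * g) ` Hgroup e \<inter> (\<lambda>g. xs ! j * g) ` Hgroup e = {})"

definition R_reps :: "'a::semigroup_mult \<Rightarrow> 'a list \<Rightarrow> bool" where
  "R_reps e ys \<longleftrightarrow> set ys \<subseteq> Rclass e \<and>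
     Rclass e = (\<Union>j<length ys. (\<lambda>g. g * ys ! j) ` Hgroup e) \<and>
     (\<forall>i<length ys. \<forall>j<length ys. i \<noteq> j \<longrightarrow>
        (\<lambda>g. g * ys ! i) ` Hgroup e \<inter> (\<lambda>g. g * ys ! j) ` Hgroup e = {})"

text \<open>Ind: block (j,i) is sigma(g_ji) where u x_i = x_j g_ji (if u x_i in L_e), else 0.
  Row index j*D+a, column index i*D+b, with D the degree of sigma.\<close>

definition Ind_rep :: "'a::semigroup_mult \<Rightarrow> 'a list \<Rightarrow> (('a \<Rightarrow> complex mat) \<times> nat) list \<Rightarrow> 'a \<Rightarrow> complex mat" where
  "Ind_rep e xs \<sigma>s u =
     (let D = dsum_dim \<sigma>s; s = length xs in
      mat (s * D) (s * D) (\<lambda>(r, c).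
        let j = r div D; a = r mod D; i = c div D; b = c mod D in
        if u * xs ! i \<in> Lclass e \<and> (\<exists>g\<in>Hgroup e. u * xs ! i = xs ! j * g)
        then dsum_rep \<sigma>s (THE g. g \<in> Hgroup e \<and> u * xs ! i = xs ! j * g) $$ (a, b)
        else 0))"

definition Coind_rep :: "'a::semigroup_mult \<Rightarrow> 'a list \<Rightarrow> (('a \<Rightarrow> complex mat) \<times> nat) list \<Rightarrow> 'a \<Rightarrow> complex mat" where
  "Coind_rep e ys \<sigma>s u =
     (let D = dsum_dim \<sigma>s; t = length ys in
      mat (t * D) (t * D) (\<lambda>(r, c).
        let j = r div D; a = r mod D; i = c div D; b = c mod D in
        if ys ! j * u \<in> Rclass e \<and> (\<exists>h\<in>Hgroup e. ys ! j * u = h * ys ! i)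
        then dsum_rep \<sigma>s (THE h. h \<in> Hgroup e \<and> ys ! j * u = h * ys ! i) $$ (a, b)
        else 0))"

definition semiunitary :: "('a \<Rightarrow> complex mat) \<Rightarrow> bool" where
  "semiunitary \<rho> \<longleftrightarrow> (\<forall>u. \<rho> u * mat_adjoint (\<rho> u) * \<rho> u = \<rho> u)"

definition has_semiunitary_schutz_pair :: "'a::semigroup_mult \<Rightarrow> bool" where
  "has_semiunitary_schutz_pair a \<longleftrightarrow>
     (\<exists>e xs ys \<sigma>s. e \<in> Jclass a \<and> idempotent e \<and> L_reps e xs \<and> R_reps e ys \<and>
        complete_irreps e \<sigma>s \<and>
        semiunitary (Ind_rep e xs \<sigma>s) \<and> semiunitary (Coind_rep e ys \<sigma>s))"

end

theory Submission
  imports Defs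
begin

text \<open>
  Suppose first that the two representations attached to \<open>e\<close> are semiunitary, and let \<open>f\<close>, \<open>f'\<close> be
  \<open>\<L>\<close>-related idempotents of the \<open>\<J>\<close>-class of \<open>e\<close>. The class \<open>L\<^sub>e\<close> meets \<open>R\<^sub>f\<close>, so
  \<open>f x\<^sub>i = x\<^sub>i\<close> for some \<open>i\<close>, and the corresponding columns of \<open>A = Ind(f)\<close> are unit vectors.
  The diagonal entries of \<open>A A\<^sup>* A = A\<close> then say that the corresponding rows have norm 1,
  so these rows are unit vectors as well. If \<open>f' x\<^sub>i = x\<^sub>k h\<close>, then \<open>f x\<^sub>k = x\<^sub>i h\<^sup>-\<^sup>1\<close> gives a nonzero block
  at \<open>(i, k)\<close>; hence \<open>k = i\<close>, \<open>f' x\<^sub>i = x\<^sub>i\<close> and \<open>f = f'\<close>. The coinduced representation treats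
  \<open>\<R>\<close>-related idempotents in the same way, and a regular semigroup in which every \<open>\<L>\<close>- and every
  \<open>\<R>\<close>-class has only one idempotent is inverse.

  Conversely, in an inverse semigroup \<open>u\<close> acts injectively on the part of \<open>L\<^sub>e\<close> that it maps into
  \<open>L\<^sub>e\<close>. Thus \<open>Ind(u)\<close> has at most one nonzero block in each block row and block column, and it is
  a partial isometry once the irreducible representations of \<open>G\<^sub>e\<close> are chosen unitary (Weyl's averaging trick
  and a Cholesky factorisation). By Schur's lemma, matrix coefficients of inequivalent unitary
  irreducible representations are orthogonal functions on \<open>G\<^sub>e\<close>, so a maximal family of such
  representations is finite and therefore complete.
\<close>

section \<open>Green classes and maximal subgroups\<close>

text \<open>As \<open>e\<close> is idempotent, \<open>x\<close> lies in the left ideal of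
  \<open>e\<close> exactly when \<open>x * e = x\<close>, and whenever \<open>e\<close> lies in the
  left ideal of \<open>x\<close> a multiplier can be found in the semigroup itself. The adjoined
  identity of S^1 thus disappears from computations with L_e.\<close>

lemma mem_Lclass_iff:
  fixes e :: "'a::semigroup_mult"
  assumes "idempotent e"
  shows "x \<in> Lclass e \<longleftrightarrow> x * e = x \<and> (\<exists>s. s * x = e)"
proof
  assume "x \<in> Lclass e"
  then have "x \<in> left_ideal1 e" "e \<in> left_ideal1 x"
    by (auto simp: Lclass_def left_ideal1_def)
  then have "x = e \<or> (\<exists>s. x = s * e)" "\<exists>s. s * x = e"
    using assms by (auto simp: left_ideal1_def idempotent_def) metis
  then show "x * e = x \<and> (\<exists>s. s * x = e)"
    using assms unfolding idempotent_def by (metis mult.assoc)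
next
  assume "x * e = x \<and> (\<exists>s. s * x = e)"
  then obtain s where "x * e = x" and s: "s * x = e" by blast
  then have "t * x = (t * x) * e" "t * e = (t * s) * x" for t
    by (simp_all add: mult.assoc)
  then have "range (\<lambda>t. t * x) = range (\<lambda>t. t * e)"
    by blast
  moreover have "x \<in> range (\<lambda>t. t * e)" "e \<in> range (\<lambda>t. t * x)"
    using \<open>x * e = x\<close> s by (metis rangeI)+
  ultimately show "x \<in> Lclass e"
    unfolding Lclass_def left_ideal1_def by auto
qed

lemma mem_Rclass_iff:
  fixes e :: "'a::semigroup_mult"
  assumes "idempotent e"
  shows "x \<in> Rclass e \<longleftrightarrow> e * x = x \<and> (\<exists>t. x * t = e)"
proof
  assume "x \<in> Rclass e"
  then have "x \<in> right_ideal1 e" "e \<in> right_ideal1 x"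
    by (auto simp: Rclass_def right_ideal1_def)
  then have "x = e \<or> (\<exists>t. x = e * t)" "\<exists>t. x * t = e"
    using assms by (auto simp: right_ideal1_def idempotent_def) metis
  then show "e * x = x \<and> (\<exists>t. x * t = e)"
    using assms unfolding idempotent_def by (metis mult.assoc)
next
  assume "e * x = x \<and> (\<exists>t. x * t = e)"
  then obtain t where "e * x = x" and t: "x * t = e" by blast
  then have "x * s = e * (x * s)" "e * s = x * (t * s)" for s
    by (simp_all add: mult.assoc[symmetric])
  then have "range ((*) x) = range ((*) e)"
    by blast
  moreover have "x \<in> range ((*) e)" "e \<in> range ((*) x)"
    using \<open>e * x = x\<close> t by (metis rangeI)+
  ultimately show "x \<in> Rclass e"
    unfolding Rclass_def right_ideal1_def by auto
qed

lemma mem_two_ideal1_idempotent: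
  fixes e :: "'a::semigroup_mult"
  assumes "idempotent e" "x \<in> two_ideal1 e"
  shows "\<exists>s t. x = s * e * t"
proof -
  have "e = e * e * e" "s * e = s * e * e" "e * t = e * e * t" for s t
    using assms(1) by (simp_all add: idempotent_def mult.assoc)
  moreover have "x = e \<or> (\<exists>s. x = s * e) \<or> (\<exists>t. x = e * t) \<or> (\<exists>s t. x = s * e * t)"
    using assms(2) by (auto simp: two_ideal1_def)
  ultimately show ?thesis by blast
qed

text \<open>Supplies the idempotent in the J-class of a regular element: \<open>a\<close> and
  \<open>a * b\<close> are multiples of each other with factors on both sides, so one inclusion of
  ideals, used twice, suffices.\<close>

lemma Jclass_mult_inverse:
  fixes a :: "'a::semigroup_mult"
  assumes "a * b * a = a"
  shows "a * b \<in> Jclass a"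
proof -
  have 1: "two_ideal1 (p * x * q) \<subseteq> two_ideal1 x" for p q x :: 'a
  proof -
    have 2: "u * x * v \<in> two_ideal1 x" for u v
      by (auto simp: two_ideal1_def)
    have "p * x * q \<in> two_ideal1 x" "s * (p * x * q) \<in> two_ideal1 x"
      "(p * x * q) * t \<in> two_ideal1 x" "s * (p * x * q) * t \<in> two_ideal1 x" for s t
      using 2[of p q] 2[of "s * p" q] 2[of p "q * t"] 2[of "s * p" "q * t"]
      by (simp_all add: mult.assoc)
    then show ?thesis by (auto simp: two_ideal1_def[of "p * x * q"])
  qed
  have "a * b = (a * b) * a * b" "a = (a * b) * (a * b) * a"
    using assms by (simp_all add: mult.assoc)
  then have "two_ideal1 (a * b) = two_ideal1 a"
    by (metis 1 subset_antisym)
  then show ?thesis by (simp add: Jclass_def)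
qed

section \<open>Idempotents of one J-class in a finite semigroup\<close>

text \<open>In the finite monoid \<open>e S e\<close> a one-sided inverse is two-sided:
  \<open>a\<close> undoes left multiplication by \<open>b\<close>, which is therefore injective and,
  by finiteness, surjective on \<open>e S\<close>; a solution \<open>c\<close> of
  \<open>b * c = e\<close> must equal \<open>a\<close>.\<close>

lemma finite_corner_inverse_commute:
  fixes e :: "'a::{finite,semigroup_mult}"
  assumes e: "e * e = e" and a: "a * e = a" "e * a = a" and b: "e * b = b" "b * e = b"
    and ab: "a * b = e"
  shows "b * a = e"
proof -
  let ?M = "{z. e * z = z}"
  have "inj_on ((*) b) ?M"
  proof (rule inj_onI)
    fix x y assume xy: "x \<in> ?M" "y \<in> ?M" "b * x = b * y"
    have "a * (b * z) = z" if "z \<in> ?M" for z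
      using that by (simp add: mult.assoc[symmetric] ab)
    then show "x = y" using xy by metis
  qed
  moreover have "((*) b) ` ?M \<subseteq> ?M"
    using b by (auto simp: mult.assoc[symmetric])
  ultimately have "((*) b) ` ?M = ?M"
    by (simp add: endo_inj_surj)
  then have "e \<in> ((*) b) ` ?M" using e by simp
  then obtain c where c: "e * c = c" "b * c = e" by auto
  have "c = a * (b * c)" by (simp add: mult.assoc[symmetric] ab c(1))
  then have "c = a" by (simp add: c(2) a(1))
  with c show ?thesis by simp
qed

text \<open>In a finite semigroup J-equivalent idempotents are D-equivalent. The element
  \<open>x\<close> lies in R_f and L_e, and \<open>y\<close> is its inverse in R_e and L_f.\<close>

lemma Jclass_idempotents_factor:
  fixes e f :: "'a::{finite,semigroup_mult}"
  assumes e: "idempotent e" and f: "idempotent f" and J: "e \<in> Jclass f"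
  obtains x y where "f * x = x" "x * e = x" "e * y = y" "y * f = y" "x * y = f" "y * x = e"
proof -
  have "e \<in> two_ideal1 f" "f \<in> two_ideal1 e"
    using J by (auto simp: Jclass_def two_ideal1_def)
  then obtain s t p q where est: "e = s * f * t" and fpq: "f = p * e * q"
    using mem_two_ideal1_idempotent e f by meson
  have ee: "e * e = e" and ff: "f * f = f" using e f by (auto simp: idempotent_def)
  \<comment> \<open>Trimming \<open>p\<close> and \<open>q\<close> by the idempotents forces the
    unit laws, and \<open>x * y = f\<close> holds because \<open>f = p * e * q\<close>.\<close>
  define x where "x = f * p * e"
  define y where "y = e * q * f"
  have xe: "x * e = x" and fx: "f * x = x" and yf: "y * f = y" and ey: "e * y = y"
    unfolding x_def y_def by (metis ee ff mult.assoc)+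
  have xy: "x * y = f"
    unfolding x_def y_def by (metis ee ff fpq mult.assoc)
  \<comment> \<open>The product collapses to \<open>e\<close> through \<open>x * y = f\<close> and
    \<open>e = s * f * t\<close>. In the corner of \<open>e\<close> the two factors may be swapped,
    which gives some \<open>w\<close> with \<open>w * x = e\<close>; multiplying
    \<open>x * y * x = x\<close> by \<open>w\<close> yields \<open>y * x = e\<close>.\<close>
  have "(e * s * x) * (y * t * e) = e * s * (x * y) * t * e"
    by (simp only: mult.assoc)
  also have "\<dots> = e * e * e"
    unfolding xy by (simp only: est mult.assoc)
  finally have "(e * s * x) * (y * t * e) = e"
    by (simp only: ee)
  then have "(y * t * e) * (e * s * x) = e"
    by (rule finite_corner_inverse_commute[of e, rotated -1])
      (simp_all only: mult.assoc xe ee, simp_all only: mult.assoc[symmetric] ee ey)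
  then have w: "(y * t * e * e * s) * x = e" by (simp only: mult.assoc)
  have "y * x = e * (y * x)"
    by (simp only: mult.assoc[symmetric] ey)
  also have "\<dots> = (y * t * e * e * s) * (x * y * x)"
    by (subst w[symmetric]) (simp only: mult.assoc)
  also have "\<dots> = e"
    by (simp only: xy fx w)
  finally have "y * x = e" .
  with that xe fx yf ey xy show ?thesis by blast
qed

section \<open>The group G_e and its actions on L_e and R_e\<close>

locale finite_idempotent =
  fixes e :: "'a::{finite,semigroup_mult}"
  assumes idem: "idempotent e"
begin

lemma ee: "e * e = e"
  using idem by (simp add: idempotent_def)

lemma mem_Hgroup_iff: "g \<in> Hgroup e \<longleftrightarrow> g * e = g \<and> e * g = g \<and> (\<exists>h. h * g = e) \<and> (\<exists>h. g * h = e)"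
  using mem_Lclass_iff[OF idem] mem_Rclass_iff[OF idem] by (auto simp: Hgroup_def)

lemma Hgroup_units: "g \<in> Hgroup e \<Longrightarrow> g * e = g" "g \<in> Hgroup e \<Longrightarrow> e * g = g"
  by (simp_all add: mem_Hgroup_iff)

lemma e_in_Hgroup: "e \<in> Hgroup e"
  using ee by (auto simp: mem_Hgroup_iff)

lemma Hgroup_mult: "g \<in> Hgroup e \<Longrightarrow> h \<in> Hgroup e \<Longrightarrow> g * h \<in> Hgroup e"
  unfolding mem_Hgroup_iff by (metis mult.assoc)

lemma Hgroup_inverse:
  assumes "g \<in> Hgroup e"
  obtains h where "h \<in> Hgroup e" "h * g = e" "g * h = e"
proof -
  obtain s t where s: "s * g = e" and t: "g * t = e" and g: "g * e = g" "e * g = g"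
    using assms by (auto simp: mem_Hgroup_iff)
  \<comment> \<open>Cutting \<open>s\<close> down to the corner keeps it a left inverse of
    \<open>g\<close>; comparison with the right inverse \<open>t\<close> then shows that it is
    two-sided.\<close>
  define h where "h = e * s * e"
  have 1: "h * g = e" "h * e = h" "e * h = h"
    unfolding h_def by (metis s g ee mult.assoc)+
  then have "h = e * t"
    by (metis t mult.assoc)
  then have "g * h = e" by (metis g(1) t mult.assoc)
  with 1 that show ?thesis by (metis mem_Hgroup_iff)
qed

text \<open>This bijection is the change of variable in sums over G_e.\<close>

lemma Hgroup_bij_mult_right:
  assumes "h \<in> Hgroup e"
  shows "bij_betw (\<lambda>g. g * h) (Hgroup e) (Hgroup e)"
proof -
  obtain k where k: "k \<in> Hgroup e" "k * h = e" "h * k = e" using Hgroup_inverse[OF assms] by blast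
  have "(\<lambda>g. g * h) ` Hgroup e \<subseteq> Hgroup e" "(\<lambda>g. g * k) ` Hgroup e \<subseteq> Hgroup e"
    using Hgroup_mult k(1) assms by blast+
  then show ?thesis
    by (intro bij_betw_byWitness[where f' = "\<lambda>g. g * k"]) (simp_all add: mult.assoc k Hgroup_units)
qed

lemma Lclass_e: "x \<in> Lclass e \<Longrightarrow> x * e = x"
  by (simp add: mem_Lclass_iff[OF idem])

lemma Rclass_e: "x \<in> Rclass e \<Longrightarrow> e * x = x"
  by (simp add: mem_Rclass_iff[OF idem])

lemma Lclass_mult_Hgroup: "x \<in> Lclass e \<Longrightarrow> g \<in> Hgroup e \<Longrightarrow> x * g \<in> Lclass e"
  unfolding mem_Lclass_iff[OF idem] mem_Hgroup_iff by (metis mult.assoc)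

lemma Hgroup_mult_Rclass: "y \<in> Rclass e \<Longrightarrow> g \<in> Hgroup e \<Longrightarrow> g * y \<in> Rclass e"
  unfolding mem_Rclass_iff[OF idem] mem_Hgroup_iff by (metis mult.assoc)

text \<open>G_e acts freely on L_e, because some multiplier takes \<open>x\<close> to
  \<open>e\<close>. This makes the \<open>THE\<close> in the induced matrix denote a well-defined
  group element.\<close>

lemma Lclass_cancel:
  assumes "x \<in> Lclass e" "g \<in> Hgroup e" "h \<in> Hgroup e" "x * g = x * h"
  shows "g = h"
  using assms unfolding mem_Lclass_iff[OF idem] mem_Hgroup_iff by (metis mult.assoc)

lemma Rclass_cancel:
  assumes "y \<in> Rclass e" "g \<in> Hgroup e" "h \<in> Hgroup e" "g * y = h * y"
  shows "g = h"
  using assms unfolding mem_Rclass_iff[OF idem] mem_Hgroup_iff by (metis mult.assoc)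

text \<open>The sets \<open>x * G_e\<close> are the orbits of the right action of the group, hence
  equal or disjoint; choosing one point in each of the finitely many orbits gives the list.\<close>

lemma L_reps_exist: "\<exists>xs. L_reps e xs"
proof -
  define C where "C x = (\<lambda>g. x * g) ` Hgroup e" for x
  have C_eq: "C x = C y" if C_xy: "x \<in> Lclass e" "y \<in> Lclass e" "C x \<inter> C y \<noteq> {}" for x y
  proof -
    have *: "C x \<subseteq> C y" if xy: "x \<in> Lclass e" "y \<in> Lclass e" "x * g = y * h" "g \<in> Hgroup e" "h \<in> Hgroup e" for x y g h
    proof -
      obtain k where k: "k \<in> Hgroup e" "g * k = e" using Hgroup_inverse[OF xy(4)] by blast
      \<comment> \<open>Since \<open>x = y * h * k\<close> with \<open>k\<close> the inverse of
        \<open>g\<close>, the whole orbit of \<open>x\<close> lies in that of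
        \<open>y\<close>.\<close>
      have "x = x * g * k" by (simp add: mult.assoc k(2) Lclass_e[OF xy(1)])
      then have "x * g' = y * (h * k * g')" for g' by (metis xy(3) mult.assoc)
      then show ?thesis
        unfolding C_def using Hgroup_mult[OF Hgroup_mult[OF xy(5) k(1)]] by blast
    qed
    obtain g h where "g \<in> Hgroup e" "h \<in> Hgroup e" "x * g = y * h"
      using C_xy(3) by (auto simp: C_def)
    with *[OF C_xy(1,2)] *[OF C_xy(2,1)] show ?thesis by (metis subset_antisym)
  qed
  \<comment> \<open>Each orbit is listed once, so different positions carry different and therefore
    disjoint orbits.\<close>
  obtain Cs where Cs: "set Cs = C ` Lclass e" "distinct Cs"
    using finite_distinct_list[of "C ` Lclass e"] by auto
  define xs where "xs = map (inv_into (Lclass e) C) Cs"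
  have CL: "C (inv_into (Lclass e) C c) = c" "inv_into (Lclass e) C c \<in> Lclass e" if "c \<in> set Cs" for c
    using that Cs by (auto simp: f_inv_into_f inv_into_into)
  have len: "length xs = length Cs" by (simp add: xs_def)
  have nth: "C (xs ! i) = Cs ! i" "xs ! i \<in> Lclass e" if "i < length Cs" for i
    using that CL by (simp_all add: xs_def)
  have self: "x \<in> C x" if "x \<in> Lclass e" for x
    using that e_in_Hgroup by (force simp: C_def mem_Lclass_iff[OF idem])
  have sub: "C x \<subseteq> Lclass e" if "x \<in> Lclass e" for x
    using that Lclass_mult_Hgroup by (auto simp: C_def)
  have "Lclass e = (\<Union>i<length xs. C (xs ! i))"
  proof -
    have "(\<Union>i<length xs. C (xs ! i)) = \<Union> (set Cs)"
      using nth(1) len by (auto simp: in_set_conv_nth Bex_def) metis+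
    also have "\<dots> = Lclass e"
      using Cs self sub by blast
    finally show ?thesis by simp
  qed
  moreover have "C (xs ! i) \<inter> C (xs ! j) = {}" if "i < length xs" "j < length xs" "i \<noteq> j" for i j
    using that nth len Cs(2) C_eq by (metis nth_eq_iff_index_eq)
  moreover have "set xs \<subseteq> Lclass e"
    using CL by (auto simp: xs_def)
  ultimately show ?thesis
    unfolding L_reps_def C_def by blast
qed

text \<open>The same orbit argument for the left action of G_e on R_e.\<close>

lemma R_reps_exist: "\<exists>ys. R_reps e ys"
proof -
  define C where "C x = (\<lambda>g. g * x) ` Hgroup e" for x
  have C_eq: "C x = C y" if C_xy: "x \<in> Rclass e" "y \<in> Rclass e" "C x \<inter> C y \<noteq> {}" for x y
  proof -
    have *: "C x \<subseteq> C y" if xy: "x \<in> Rclass e" "y \<in> Rclass e" "g * x = h * y" "g \<in> Hgroup e" "h \<in> Hgroup e" for x y g h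
    proof -
      obtain k where k: "k \<in> Hgroup e" "k * g = e" using Hgroup_inverse[OF xy(4)] by blast
      have "x = k * (g * x)" by (simp add: mult.assoc[symmetric] k(2) Rclass_e[OF xy(1)])
      then have "g' * x = (g' * (k * h)) * y" for g' by (metis xy(3) mult.assoc)
      then show ?thesis
        unfolding C_def using Hgroup_mult[OF _ Hgroup_mult[OF k(1) xy(5)]] by blast
    qed
    obtain g h where "g \<in> Hgroup e" "h \<in> Hgroup e" "g * x = h * y"
      using C_xy(3) by (auto simp: C_def)
    with *[OF C_xy(1,2)] *[OF C_xy(2,1)] show ?thesis by (metis subset_antisym)
  qed
  obtain Cs where Cs: "set Cs = C ` Rclass e" "distinct Cs"
    using finite_distinct_list[of "C ` Rclass e"] by auto
  define ys where "ys = map (inv_into (Rclass e) C) Cs"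
  have CL: "C (inv_into (Rclass e) C c) = c" "inv_into (Rclass e) C c \<in> Rclass e" if "c \<in> set Cs" for c
    using that Cs by (auto simp: f_inv_into_f inv_into_into)
  have len: "length ys = length Cs" by (simp add: ys_def)
  have nth: "C (ys ! i) = Cs ! i" "ys ! i \<in> Rclass e" if "i < length Cs" for i
    using that CL by (simp_all add: ys_def)
  have self: "x \<in> C x" if "x \<in> Rclass e" for x
    using that e_in_Hgroup by (force simp: C_def mem_Rclass_iff[OF idem])
  have sub: "C x \<subseteq> Rclass e" if "x \<in> Rclass e" for x
    using that Hgroup_mult_Rclass by (auto simp: C_def)
  have "Rclass e = (\<Union>i<length ys. C (ys ! i))"
  proof -
    have "(\<Union>i<length ys. C (ys ! i)) = \<Union> (set Cs)"
      using nth(1) len by (auto simp: in_set_conv_nth Bex_def) metis+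
    also have "\<dots> = Rclass e"
      using Cs self sub by blast
    finally show ?thesis by simp
  qed
  moreover have "C (ys ! i) \<inter> C (ys ! j) = {}" if "i < length ys" "j < length ys" "i \<noteq> j" for i j
    using that nth len Cs(2) C_eq by (metis nth_eq_iff_index_eq)
  moreover have "set ys \<subseteq> Rclass e"
    using CL by (auto simp: ys_def)
  ultimately show ?thesis
    unfolding R_reps_def C_def by blast
qed

end

section \<open>Matrices and partial isometries\<close>

lemma mat_adjoint_carrier: "A \<in> carrier_mat n m \<Longrightarrow> mat_adjoint A \<in> carrier_mat m n"
  by (simp add: mat_adjoint_def mat_of_rows_def)

lemma mat_adjoint_index:
  fixes A :: "complex mat"
  assumes "A \<in> carrier_mat n m" "i < m" "j < n"
  shows "mat_adjoint A $$ (i, j) = cnj (A $$ (j, i))"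
proof -
  have "cols A ! i = col A i" "length (cols A) = m" "dim_row A = n" "col A i $ j = A $$ (j, i)"
    using assms by simp_all
  then show ?thesis
    using assms by (simp add: mat_adjoint_def mat_of_rows_def)
qed

lemma mult_mat_index:
  assumes "A \<in> carrier_mat n m" "B \<in> carrier_mat m p" "i < n" "j < p"
  shows "(A * B) $$ (i, j) = (\<Sum>k<m. A $$ (i, k) * B $$ (k, j))"
proof -
  have "(A * B) $$ (i, j) = (\<Sum>k<m. row A i $ k * col B j $ k)"
    using assms by (simp add: scalar_prod_def atLeast0LessThan)
  also have "\<dots> = (\<Sum>k<m. A $$ (i, k) * B $$ (k, j))"
    using assms by (intro sum.cong refl) simp
  finally show ?thesis .
qed

section \<open>Partial isometries\<close>

lemma mult_mat_adjoint_mult_index: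
  fixes A :: "complex mat"
  assumes A: "A \<in> carrier_mat n n" and "i < n" "j < n"
  shows "(A * mat_adjoint A * A) $$ (i, j) =
    (\<Sum>l<n. (\<Sum>k<n. A $$ (i, k) * cnj (A $$ (l, k))) * A $$ (l, j))"
proof -
  note A' = mat_adjoint_carrier[OF A]
  show ?thesis
    unfolding mult_mat_index[OF mult_carrier_mat[OF A A'] A assms(2,3)]
    by (intro sum.cong refl arg_cong2[where f = "(*)"])
      (auto simp: mult_mat_index[OF A A' assms(2)] mat_adjoint_index[OF A] simp del: index_mult_mat)
qed

text \<open>When column \<open>r\<close> is a unit vector, the diagonal entry of
  \<open>A A^* A\<close> at \<open>r\<close> is the squared norm of row \<open>r\<close>. It equals
  1, and the entry 1 at \<open>(r, r)\<close> already exhausts this norm.\<close>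

lemma partial_isometry_unit_col_imp_unit_row:
  fixes A :: "complex mat"
  assumes A: "A \<in> carrier_mat n n" and iso: "A * mat_adjoint A * A = A" and r: "r < n"
    and col: "\<And>l. l < n \<Longrightarrow> A $$ (l, r) = (if l = r then 1 else 0)"
    and c: "c < n" "c \<noteq> r"
  shows "A $$ (r, c) = 0"
proof -
  have "1 = (A * mat_adjoint A * A) $$ (r, r)"
    by (simp only: iso col[OF r] simp_thms if_True)
  also have "\<dots> = (\<Sum>l<n. if l = r then (\<Sum>k<n. A $$ (r, k) * cnj (A $$ (r, k))) else 0)"
    unfolding mult_mat_adjoint_mult_index[OF A r r] by (intro sum.cong) (auto simp: col)
  also have "\<dots> = of_real (\<Sum>k<n. (cmod (A $$ (r, k)))\<^sup>2)"
    using r by (simp del: of_real_power add: complex_norm_square)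
  finally have "(\<Sum>k<n. (cmod (A $$ (r, k)))\<^sup>2) = 1"
    using of_real_eq_1_iff by metis
  then have "(\<Sum>k\<in>{..<n} - {r}. (cmod (A $$ (r, k)))\<^sup>2) = 0"
    using r col[OF r] by (simp add: sum.remove[of _ r])
  then show ?thesis
    using c by (simp add: sum_nonneg_eq_0_iff)
qed

text \<open>When row \<open>r\<close> is a unit vector, row \<open>r\<close> of \<open>A A^*\<close>
  is the conjugate of column \<open>r\<close> of \<open>A\<close>, so the diagonal entry of
  \<open>A A^* A\<close> at \<open>r\<close> is the squared norm of that column.\<close>

lemma partial_isometry_unit_row_imp_unit_col:
  fixes A :: "complex mat"
  assumes A: "A \<in> carrier_mat n n" and iso: "A * mat_adjoint A * A = A" and r: "r < n"
    and row: "\<And>l. l < n \<Longrightarrow> A $$ (r, l) = (if l = r then 1 else 0)"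
    and c: "c < n" "c \<noteq> r"
  shows "A $$ (c, r) = 0"
proof -
  have "(\<Sum>k<n. A $$ (r, k) * cnj (A $$ (l, k))) = cnj (A $$ (l, r))" for l
  proof -
    have "(\<Sum>k<n. A $$ (r, k) * cnj (A $$ (l, k))) = (\<Sum>k<n. if k = r then cnj (A $$ (l, r)) else 0)"
      by (intro sum.cong) (auto simp: row)
    then show ?thesis using r by simp
  qed
  then have "(A * mat_adjoint A * A) $$ (r, r) = (\<Sum>l<n. cnj (A $$ (l, r)) * A $$ (l, r))"
    unfolding mult_mat_adjoint_mult_index[OF A r r] by simp
  also have "\<dots> = of_real (\<Sum>k<n. (cmod (A $$ (k, r)))\<^sup>2)"
    by (simp only: of_real_sum complex_norm_square mult.commute)
  finally have "of_real (\<Sum>k<n. (cmod (A $$ (k, r)))\<^sup>2) = (1::complex)"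
    by (simp only: iso row[OF r] simp_thms if_True)
  then have "(\<Sum>k<n. (cmod (A $$ (k, r)))\<^sup>2) = 1"
    using of_real_eq_1_iff by metis
  then have "(\<Sum>k\<in>{..<n} - {r}. (cmod (A $$ (k, r)))\<^sup>2) = 0"
    using r row[OF r] by (simp add: sum.remove[of _ r])
  then show ?thesis
    using c by (simp add: sum_nonneg_eq_0_iff)
qed

text \<open>The equation \<open>U^* U = 1\<close> is orthonormality of the columns; for square
  matrices it also yields \<open>U U^* = 1\<close>.\<close>

definition unitary_mat :: "nat \<Rightarrow> complex mat \<Rightarrow> bool" where
  "unitary_mat d U \<longleftrightarrow> U \<in> carrier_mat d d \<and> mat_adjoint U * U = 1\<^sub>m d"

lemma unitary_mat_col_orth:
  assumes "unitary_mat d U" "a < d" "b < d"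
  shows "(\<Sum>k<d. cnj (U $$ (k, a)) * U $$ (k, b)) = (if a = b then 1 else 0)"
proof -
  have U: "U \<in> carrier_mat d d" using assms by (simp add: unitary_mat_def)
  have "(\<Sum>k<d. cnj (U $$ (k, a)) * U $$ (k, b)) = (mat_adjoint U * U) $$ (a, b)"
    using assms by (simp add: mult_mat_index[OF mat_adjoint_carrier[OF U] U] mat_adjoint_index[OF U])
  then show ?thesis using assms by (simp add: unitary_mat_def)
qed

lemma block_index:
  fixes i s D b :: nat
  assumes "i < s" "b < D"
  shows "i * D + b < s * D" "(i * D + b) div D = i" "(i * D + b) mod D = b"
proof -
  have "i * D + b < Suc i * D" using assms(2) by simp
  also have "\<dots> \<le> s * D" using assms(1) by (intro mult_le_mono1) simp
  finally show "i * D + b < s * D" .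
qed (use assms in auto)

lemma sum_single_block:
  fixes f :: "nat \<Rightarrow> 'b::comm_monoid_add"
  assumes j: "j < s" and 0: "\<And>l. l < s * D \<Longrightarrow> l div D \<noteq> j \<Longrightarrow> f l = 0"
  shows "(\<Sum>l<s * D. f l) = (\<Sum>a<D. f (j * D + a))"
proof -
  let ?B = "(\<lambda>a. j * D + a) ` {..<D}"
  have le: "j * D + D \<le> s * D"
    using mult_le_mono1[of "Suc j" s D] j by simp
  have sub: "?B \<subseteq> {..<s * D}" using le by auto
  have "f l = 0" if l: "l \<in> {..<s * D} - ?B" for l
  proof (rule 0)
    show "l div D \<noteq> j"
    proof
      assume "l div D = j"
      moreover have "D > 0" using l by (cases D) auto
      ultimately have "l = j * D + l mod D" "l mod D < D" by auto
      then show False using l by blast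
    qed
  qed (use l in simp)
  then have "(\<Sum>l<s * D. f l) = sum f ?B"
    using sub by (intro sum.mono_neutral_right) auto
  also have "\<dots> = (\<Sum>a<D. f (j * D + a))"
    by (subst sum.reindex) (auto simp: inj_on_def)
  finally show ?thesis .
qed

text \<open>\<open>M j i\<close> marks the nonzero blocks, and \<open>func\<close> and
  \<open>inj\<close> make it the graph of a partial injection. Then \<open>A^* A\<close> is the
  diagonal projection onto the block columns that carry a block, and \<open>A\<close> is unchanged
  by this projection on the right.\<close>

lemma partial_monomial_unitary_blocks_semiunitary:
  fixes A :: "complex mat" and M :: "nat \<Rightarrow> nat \<Rightarrow> bool" and U :: "nat \<Rightarrow> nat \<Rightarrow> complex mat"
  assumes A: "A \<in> carrier_mat (s * D) (s * D)"
    and entries: "\<And>r c. r < s * D \<Longrightarrow> c < s * D \<Longrightarrow> A $$ (r, c) =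
       (if M (r div D) (c div D) then U (r div D) (c div D) $$ (r mod D, c mod D) else 0)"
    and unit: "\<And>j i. j < s \<Longrightarrow> i < s \<Longrightarrow> M j i \<Longrightarrow> unitary_mat D (U j i)"
    and func: "\<And>j j' i. \<lbrakk>j < s; j' < s; i < s; M j i; M j' i\<rbrakk> \<Longrightarrow> j = j'"
    and inj: "\<And>j i i'. \<lbrakk>j < s; i < s; i' < s; M j i; M j i'\<rbrakk> \<Longrightarrow> i = i'"
  shows "A * mat_adjoint A * A = A"
proof -
  let ?n = "s * D"
  let ?T = "mat_adjoint A * A"
  have A': "mat_adjoint A \<in> carrier_mat ?n ?n" using mat_adjoint_carrier[OF A] .
  have T: "?T \<in> carrier_mat ?n ?n" using A A' by simp
  have div: "k div D < s" "k mod D < D" if "k < ?n" for k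
  proof -
    \<comment> \<open>For \<open>D = 0\<close> there would be no index at all.\<close>
    have "D > 0" using that by (cases D) auto
    then show "k div D < s" "k mod D < D" using that by (auto simp: less_mult_imp_div_less)
  qed
  have T_index: "?T $$ (k, c) = (if k = c \<and> (\<exists>j<s. M j (c div D)) then 1 else 0)"
    if k: "k < ?n" and c: "c < ?n" for k c
  proof -
    have T1: "?T $$ (k, c) = (\<Sum>l<?n. cnj (A $$ (l, k)) * A $$ (l, c))"
      using k c by (simp add: mult_mat_index[OF A' A] mat_adjoint_index[OF A])
    show ?thesis
    proof (cases "\<exists>j<s. M j (c div D)")
      case False
      then have "A $$ (l, c) = 0" if "l < ?n" for l
        using that c div(1)[OF that] by (simp add: entries)
      then show ?thesis using False T1 by simp
    next
      case True
      then obtain j where j: "j < s" "M j (c div D)" by blast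
      \<comment> \<open>Column \<open>c\<close> vanishes outside block row \<open>j\<close>, so only
        the rows of that block contribute.\<close>
      have "(\<Sum>l<?n. cnj (A $$ (l, k)) * A $$ (l, c)) =
          (\<Sum>a<D. cnj (A $$ (j * D + a, k)) * A $$ (j * D + a, c))"
      proof (rule sum_single_block[OF j(1)])
        fix l assume l: "l < ?n" "l div D \<noteq> j"
        then have "\<not> M (l div D) (c div D)"
          using func[of "l div D" j "c div D"] j div c by blast
        then show "cnj (A $$ (l, k)) * A $$ (l, c) = 0"
          using l c by (simp add: entries)
      qed
      also have "\<dots> = (\<Sum>a<D. if M j (k div D)
          then cnj (U j (k div D) $$ (a, k mod D)) * U j (c div D) $$ (a, c mod D) else 0)"
      proof (rule sum.cong[OF refl])
        fix a assume a: "a \<in> {..<D}"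
        have "j * D + a < Suc j * D" using a by simp
        also have "\<dots> \<le> ?n" using j by (intro mult_le_mono1) simp
        finally have "j * D + a < ?n" .
        then show "cnj (A $$ (j * D + a, k)) * A $$ (j * D + a, c) = (if M j (k div D)
          then cnj (U j (k div D) $$ (a, k mod D)) * U j (c div D) $$ (a, c mod D) else 0)"
          using a k c j by (simp add: entries)
      qed
      also have "\<dots> = (if k = c then 1 else 0)"
      proof (cases "M j (k div D)")
        case True
        \<comment> \<open>Two columns meeting in block row \<open>j\<close> lie in the same block
          column, where both are columns of one unitary matrix.\<close>
        then have kc: "k div D = c div D" using inj j div k c by blast
        then have "k = c \<longleftrightarrow> k mod D = c mod D" by (metis div_mult_mod_eq)
        then show ?thesis
          using True kc unitary_mat_col_orth[OF unit[OF j(1) div(1)[OF c] j(2)] div(2)[OF k] div(2)[OF c]]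
          by simp
      next
        case False
        then have "k \<noteq> c" using j by auto
        then show ?thesis using False by simp
      qed
      finally show ?thesis using T1 True by simp
    qed
  qed
  have "A * ?T = A"
  proof (rule eq_matI)
    fix r c assume "r < dim_row A" "c < dim_col A"
    then have r: "r < ?n" and c: "c < ?n" using A by auto
    have "(A * ?T) $$ (r, c) = (\<Sum>k<?n. if k = c then (if \<exists>j<s. M j (c div D) then A $$ (r, c) else 0) else 0)"
      unfolding mult_mat_index[OF A T r c] using c by (intro sum.cong) (auto simp: T_index)
    also have "\<dots> = (if \<exists>j<s. M j (c div D) then A $$ (r, c) else 0)"
      using c by simp
    \<comment> \<open>A column removed by the projection carries no block and was zero from the
      start.\<close>
    also have "\<dots> = A $$ (r, c)"
      using entries[OF r c] div(1)[OF r] by auto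
    finally show "(A * ?T) $$ (r, c) = A $$ (r, c)" .
  qed (use A in auto)
  then show ?thesis by (simp only: assoc_mult_mat[OF A A' A])
qed

section \<open>Cholesky factorisation and families of orthogonal functions\<close>

lemma sum_rotate:
  "(\<Sum>i\<in>A. \<Sum>j\<in>B. \<Sum>g\<in>G. f i j g) = (\<Sum>g\<in>G. \<Sum>i\<in>A. \<Sum>j\<in>B. f i j g)"
proof -
  have "(\<Sum>i\<in>A. \<Sum>j\<in>B. \<Sum>g\<in>G. f i j g) = (\<Sum>i\<in>A. \<Sum>g\<in>G. \<Sum>j\<in>B. f i j g)"
    by (intro sum.cong refl) (rule sum.swap)
  also have "\<dots> = (\<Sum>g\<in>G. \<Sum>i\<in>A. \<Sum>j\<in>B. f i j g)"
    by (rule sum.swap)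
  finally show ?thesis .
qed

text \<open>This is \<open>H = C^* C\<close> for a positive definite Hermitian matrix. Induction by
  Schur complements: the last coordinate is eliminated, the remaining form stays positive definite,
  and the factor found for it is bordered by one new row.\<close>

lemma cholesky_factor:
  fixes H :: "nat \<Rightarrow> nat \<Rightarrow> complex"
  assumes "\<And>i j. i < n \<Longrightarrow> j < n \<Longrightarrow> H j i = cnj (H i j)"
    and "\<And>v. \<exists>i<n. v i \<noteq> 0 \<Longrightarrow> 0 < Re (\<Sum>i<n. \<Sum>j<n. cnj (v i) * H i j * v j)"
  shows "\<exists>C. \<forall>i<n. \<forall>j<n. (\<Sum>k<n. cnj (C k i) * C k j) = H i j"
  using assms
proof (induction n arbitrary: H)
  case 0
  then show ?case by simp
next
  case (Suc n)
  define a where "a = Re (H n n)"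
  \<comment> \<open>Positivity at the last unit vector makes the pivot positive.\<close>
  have "0 < Re (\<Sum>i<Suc n. \<Sum>j<Suc n. cnj (if i = n then 1 else 0) * H i j * (if j = n then 1 else 0))"
    by (rule Suc.prems(2)) auto
  then have a: "a > 0" by (simp add: a_def)
  have Hnn: "H n n = of_real a"
    using Suc.prems(1)[of n n] by (simp add: a_def complex_eq_iff)
  have herm: "cnj (H i n) = H n i" if "i < n" for i
    using Suc.prems(1)[of i n] that by simp
  \<comment> \<open>The Schur complement of the pivot \<open>H n n\<close>.\<close>
  define H' where "H' i j = H i j - H i n * H n j / of_real a" for i j
  have "\<exists>C. \<forall>i<n. \<forall>j<n. (\<Sum>k<n. cnj (C k i) * C k j) = H' i j"
  proof (rule Suc.IH)
    fix i j assume "i < n" "j < n"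
    then show "H' j i = cnj (H' i j)"
      using Suc.prems(1)[of i j] Suc.prems(1)[of i n] Suc.prems(1)[of j n] by (simp add: H'_def)
  next
    fix v :: "nat \<Rightarrow> complex" assume v: "\<exists>i<n. v i \<noteq> 0"
    define s where "s = (\<Sum>j<n. H n j * v j)"
    \<comment> \<open>The last coordinate minimises the form of \<open>H\<close> over all extensions
      of \<open>v\<close>; for this choice its value is that of \<open>H'\<close> at
      \<open>v\<close>, so positivity passes to \<open>H'\<close>.\<close>
    define w where "w = v(n := - s / of_real a)"
    have t: "(\<Sum>i<n. cnj (v i) * H i n) = cnj s"
      unfolding s_def cnj_sum using herm Suc.prems(1)[of _ n]
      by (intro sum.cong) (auto simp: mult.commute)
    have wn: "w n = - s / of_real a" and wi: "i < n \<Longrightarrow> w i = v i" for i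
      by (auto simp: w_def)
    have "(\<Sum>i<Suc n. \<Sum>j<Suc n. cnj (w i) * H i j * w j) =
        (\<Sum>i<n. \<Sum>j<n. cnj (v i) * H i j * v j) + (\<Sum>i<n. cnj (v i) * H i n) * w n
        + cnj (w n) * s + cnj (w n) * H n n * w n"
      by (simp add: sum.distrib wi s_def sum_distrib_left sum_distrib_right mult.assoc)
    also have "\<dots> = (\<Sum>i<n. \<Sum>j<n. cnj (v i) * H i j * v j) - cnj s * s / of_real a"
      using a unfolding t wn Hnn by (simp add: field_simps)
    also have "cnj s * s / of_real a = (\<Sum>i<n. \<Sum>j<n. cnj (v i) * (H i n * H n j / of_real a) * v j)"
      unfolding t[symmetric] unfolding s_def sum_product sum_divide_distrib by (simp add: mult_ac)
    also have "(\<Sum>i<n. \<Sum>j<n. cnj (v i) * H i j * v j) - \<dots> = (\<Sum>i<n. \<Sum>j<n. cnj (v i) * H' i j * v j)"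
      by (simp add: H'_def sum_subtractf algebra_simps)
    finally have eq: "(\<Sum>i<Suc n. \<Sum>j<Suc n. cnj (w i) * H i j * w j) = (\<Sum>i<n. \<Sum>j<n. cnj (v i) * H' i j * v j)" .
    have "\<exists>i<Suc n. w i \<noteq> 0" using v wi by (metis less_SucI)
    from Suc.prems(2)[OF this] show "0 < Re (\<Sum>i<n. \<Sum>j<n. cnj (v i) * H' i j * v j)"
      unfolding eq .
  qed
  then obtain C where C: "\<And>i j. i < n \<Longrightarrow> j < n \<Longrightarrow> (\<Sum>k<n. cnj (C k i) * C k j) = H' i j"
    by blast
  \<comment> \<open>Row \<open>n\<close> contributes \<open>H i n * H n j / a\<close>, exactly what
    was subtracted in \<open>H'\<close>. Column \<open>n\<close> vanishes off that row, since for
    \<open>i = n\<close> or \<open>j = n\<close> this contribution is already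
    \<open>H i j\<close>.\<close>
  define D where "D k j = (if k = n then H n j / of_real (sqrt a) else if j = n then 0 else C k j)" for k j
  have sq: "complex_of_real (sqrt a) * of_real (sqrt a) = of_real a"
    using a by (metis of_real_mult real_sqrt_mult_self abs_of_pos)
  have "(\<Sum>k<Suc n. cnj (D k i) * D k j) = H i j" if ij: "i < Suc n" "j < Suc n" for i j
  proof -
    have cn: "cnj (H n i) = H i n" using Suc.prems(1)[of n i] ij by simp
    have last: "cnj (D n i) * D n j = H i n * H n j / of_real a"
      by (simp add: D_def cn sq)
    have "(\<Sum>k<n. cnj (D k i) * D k j) = (if i = n \<or> j = n then 0 else H' i j)"
    proof (cases "i = n \<or> j = n")
      case True
      then show ?thesis by (auto simp: D_def intro!: sum.neutral)
    next
      case False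
      then have "(\<Sum>k<n. cnj (D k i) * D k j) = (\<Sum>k<n. cnj (C k i) * C k j)"
        by (intro sum.cong) (auto simp: D_def)
      then show ?thesis using C False ij by simp
    qed
    then show ?thesis using last a ij by (auto simp: Hnn H'_def)
  qed
  then show ?case by blast
qed


text \<open>More than \<open>card G\<close> functions on \<open>G\<close> satisfy a nontrivial
  linear relation; pairing it with each \<open>f l\<close> shows that every coefficient
  vanishes.\<close>

lemma orthogonal_family_le_card:
  fixes f :: "nat \<Rightarrow> 'g \<Rightarrow> complex"
  assumes "finite G"
    and orth: "\<And>k l. k < n \<Longrightarrow> l < n \<Longrightarrow> k \<noteq> l \<Longrightarrow> (\<Sum>g\<in>G. cnj (f k g) * f l g) = 0"
    and nz: "\<And>k. k < n \<Longrightarrow> (\<Sum>g\<in>G. cnj (f k g) * f k g) \<noteq> 0"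
  shows "n \<le> card G"
proof (rule ccontr)
  assume "\<not> n \<le> card G"
  then have mn: "card G < n" by simp
  obtain \<phi> where \<phi>: "bij_betw \<phi> {0..<card G} G"
    using ex_bij_betw_nat_finite[OF \<open>finite G\<close>] by blast
  \<comment> \<open>The table of values is padded with zero rows to a square matrix, so that the
    determinant criterion gives a kernel vector.\<close>
  define M where "M = mat n n (\<lambda>(i, k). if i < card G then f k (\<phi> i) else 0)"
  have M: "M \<in> carrier_mat n n" by (simp add: M_def)
  \<comment> \<open>Row \<open>card G\<close> is the first padding row, which exists because
    \<open>card G < n\<close>.\<close>
  have "transpose_mat M *\<^sub>v unit_vec n (card G) = 0\<^sub>v n"
  proof (rule eq_vecI)
    fix i assume "i < dim_vec (0\<^sub>v n :: complex vec)"
    then have i: "i < n" by simp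
    then have "(transpose_mat M *\<^sub>v unit_vec n (card G)) $ i = col M i $ card G"
      using M mn by (simp add: scalar_prod_right_unit)
    also have "\<dots> = 0" using i mn by (simp add: M_def)
    finally show "(transpose_mat M *\<^sub>v unit_vec n (card G)) $ i = 0\<^sub>v n $ i" using i by simp
  qed (use M in simp)
  moreover have "unit_vec n (card G) \<noteq> (0\<^sub>v n :: complex vec)"
    using mn by (metis index_unit_vec(1) index_zero_vec(1) zero_neq_one)
  ultimately have "det (transpose_mat M) = 0"
    using det_0_iff_vec_prod_zero[OF transpose_carrier_mat[THEN iffD2, OF M]] unit_vec_carrier by blast
  then have "det M = 0" using det_transpose[OF M] by simp
  then obtain v where v: "v \<in> carrier_vec n" "v \<noteq> 0\<^sub>v n" "M *\<^sub>v v = 0\<^sub>v n"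
    using det_0_iff_vec_prod_zero[OF M] by blast
  have comb: "(\<Sum>k<n. f k g * v $ k) = 0" if g: "g \<in> G" for g
  proof -
    obtain i where i: "i < card G" "g = \<phi> i"
      using \<phi> g bij_betw_imp_surj_on[OF \<phi>] by fastforce
    have "(M *\<^sub>v v) $ i = (\<Sum>k<n. row M i $ k * v $ k)"
      using i mn M v(1) by (simp add: scalar_prod_def atLeast0LessThan)
    also have "\<dots> = (\<Sum>k<n. f k g * v $ k)"
      using i mn by (intro sum.cong) (auto simp: M_def)
    finally show ?thesis using v(3) i mn by simp
  qed
  have "v $ l = 0" if l: "l < n" for l
  proof -
    have "0 = (\<Sum>g\<in>G. cnj (f l g) * (\<Sum>k<n. f k g * v $ k))"
      by (simp add: comb)
    also have "\<dots> = (\<Sum>k<n. (\<Sum>g\<in>G. cnj (f l g) * f k g) * v $ k)"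
      unfolding sum_distrib_left sum_distrib_right by (subst sum.swap) (simp add: mult.assoc)
    also have "\<dots> = (\<Sum>k<n. if k = l then (\<Sum>g\<in>G. cnj (f l g) * f l g) * v $ l else 0)"
      using orth l by (intro sum.cong) auto
    also have "\<dots> = (\<Sum>g\<in>G. cnj (f l g) * f l g) * v $ l"
      using l by simp
    finally show ?thesis using nz[OF l] by simp
  qed
  then have "v = 0\<^sub>v n" using v(1) by (intro eq_vecI) auto
  with v(2) show False by simp
qed

section \<open>Inverses, adjoints and block diagonal matrices\<close>

lemma invertible_matE:
  assumes "P \<in> carrier_mat d d" "invertible_mat P"
  obtains Q where "Q \<in> carrier_mat d d" "P * Q = 1\<^sub>m d" "Q * P = 1\<^sub>m d"
proof -
  obtain Q where Q: "P * Q = 1\<^sub>m d" "Q * P = 1\<^sub>m (dim_row Q)"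
    using assms by (auto simp: invertible_mat_def inverts_mat_def)
  have "dim_col Q = d" "dim_row Q = d"
    using arg_cong[OF Q(1), of dim_col] arg_cong[OF Q(2), of dim_col] assms(1) by auto
  with Q that show ?thesis by (metis carrier_matI)
qed

lemma invertible_matI:
  assumes "P \<in> carrier_mat d d" "Q \<in> carrier_mat d d" "P * Q = 1\<^sub>m d" "Q * P = 1\<^sub>m d"
  shows "invertible_mat P"
  using assms unfolding invertible_mat_def inverts_mat_def by (intro conjI exI[of _ Q]) auto

lemma mat_eq_if_mult_vec_eq:
  fixes A B :: "complex mat"
  assumes "A \<in> carrier_mat n m" "B \<in> carrier_mat n m"
    and "\<And>v. v \<in> carrier_vec m \<Longrightarrow> A *\<^sub>v v = B *\<^sub>v v"
  shows "A = B"
proof (rule eq_matI)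
  fix i j assume "i < dim_row B" "j < dim_col B"
  then have ij: "i < n" "j < m" using assms(2) by auto
  have "C $$ (i, j) = (C *\<^sub>v unit_vec m j) $ i" if "C \<in> carrier_mat n m" for C :: "complex mat"
    using that ij by (simp add: scalar_prod_right_unit)
  then show "A $$ (i, j) = B $$ (i, j)"
    using assms by (metis unit_vec_carrier)
qed (use assms in auto)

text \<open>The traces of \<open>T * S\<close> and \<open>S * T\<close> agree, and they are
  \<open>m\<close> and \<open>n\<close>.\<close>

lemma two_sided_inverse_square:
  fixes S T :: "complex mat"
  assumes T: "T \<in> carrier_mat m n" and S: "S \<in> carrier_mat n m"
    and TS: "T * S = 1\<^sub>m m" and ST: "S * T = 1\<^sub>m n"
  shows "m = n"
proof -
  have "of_nat m = (\<Sum>i<m. (T * S) $$ (i, i))" by (simp add: TS)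
  also have "\<dots> = (\<Sum>i<m. \<Sum>k<n. T $$ (i, k) * S $$ (k, i))"
    by (intro sum.cong refl mult_mat_index[OF T S]) auto
  also have "\<dots> = (\<Sum>k<n. \<Sum>i<m. S $$ (k, i) * T $$ (i, k))"
    by (subst sum.swap) (simp add: mult.commute)
  also have "\<dots> = (\<Sum>k<n. (S * T) $$ (k, k))"
    by (intro sum.cong refl mult_mat_index[OF S T, symmetric]) auto
  also have "\<dots> = of_nat n" by (simp add: ST)
  finally show ?thesis using of_nat_eq_iff by blast
qed

lemma mat_adjoint_mult:
  fixes A B :: "complex mat"
  assumes A: "A \<in> carrier_mat n m" and B: "B \<in> carrier_mat m p"
  shows "mat_adjoint (A * B) = mat_adjoint B * mat_adjoint A"
proof (rule eq_matI)
  note AB = mult_carrier_mat[OF A B]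
  note A' = mat_adjoint_carrier[OF A] and B' = mat_adjoint_carrier[OF B]
  fix i j assume "i < dim_row (mat_adjoint B * mat_adjoint A)" "j < dim_col (mat_adjoint B * mat_adjoint A)"
  then have ij: "i < p" "j < n" using A' B' by auto
  show "mat_adjoint (A * B) $$ (i, j) = (mat_adjoint B * mat_adjoint A) $$ (i, j)"
    using ij unfolding mat_adjoint_index[OF AB ij] mult_mat_index[OF A B ij(2,1)]
      mult_mat_index[OF B' A' ij] cnj_sum
    by (intro sum.cong refl) (simp add: mat_adjoint_index[OF A] mat_adjoint_index[OF B] mult.commute)
qed (use mat_adjoint_carrier[OF A] mat_adjoint_carrier[OF B] mat_adjoint_carrier[OF mult_carrier_mat[OF A B]] in auto)

lemma mat_adjoint_one: "mat_adjoint (1\<^sub>m d :: complex mat) = 1\<^sub>m d"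
  by (rule eq_matI) (use mat_adjoint_carrier[OF one_carrier_mat[of d, where 'a = complex]] in
     \<open>auto simp: mat_adjoint_index[OF one_carrier_mat]\<close>)

lemma mat_adjoint_four_block_diag:
  fixes A B :: "complex mat"
  assumes A: "A \<in> carrier_mat n n" and B: "B \<in> carrier_mat m m"
  shows "mat_adjoint (four_block_mat A (0\<^sub>m n m) (0\<^sub>m m n) B) =
    four_block_mat (mat_adjoint A) (0\<^sub>m n m) (0\<^sub>m m n) (mat_adjoint B)"
proof (rule eq_matI)
  note A' = mat_adjoint_carrier[OF A] and B' = mat_adjoint_carrier[OF B]
  let ?F = "four_block_mat A (0\<^sub>m n m) (0\<^sub>m m n) B"
  have F: "?F \<in> carrier_mat (n + m) (n + m)" using A B by simp
  fix i j assume "i < dim_row (four_block_mat (mat_adjoint A) (0\<^sub>m n m) (0\<^sub>m m n) (mat_adjoint B))"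
    "j < dim_col (four_block_mat (mat_adjoint A) (0\<^sub>m n m) (0\<^sub>m m n) (mat_adjoint B))"
  then have ij: "i < n + m" "j < n + m" using A' B' by auto
  show "mat_adjoint ?F $$ (i, j) =
    four_block_mat (mat_adjoint A) (0\<^sub>m n m) (0\<^sub>m m n) (mat_adjoint B) $$ (i, j)"
    using ij A B A' B' unfolding mat_adjoint_index[OF F ij]
    by (auto simp: mat_adjoint_index[OF A] mat_adjoint_index[OF B])
qed (use mat_adjoint_carrier[OF A] mat_adjoint_carrier[OF B]
      mat_adjoint_carrier[OF four_block_carrier_mat[OF A B]] in auto)

lemma mult_four_block_diag:
  fixes A B A' B' :: "complex mat"
  assumes "A \<in> carrier_mat n n" "B \<in> carrier_mat m m" "A' \<in> carrier_mat n n" "B' \<in> carrier_mat m m"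
  shows "four_block_mat A (0\<^sub>m n m) (0\<^sub>m m n) B * four_block_mat A' (0\<^sub>m n m) (0\<^sub>m m n) B' =
    four_block_mat (A * A') (0\<^sub>m n m) (0\<^sub>m m n) (B * B')"
  using assms by (subst mult_four_block_mat) auto

section \<open>Direct sums of representations\<close>

lemma dsum_rep_carrier:
  "(\<And>\<rho> d. (\<rho>, d) \<in> set \<sigma>s \<Longrightarrow> \<rho> g \<in> carrier_mat d d) \<Longrightarrow>
    dsum_rep \<sigma>s g \<in> carrier_mat (dsum_dim \<sigma>s) (dsum_dim \<sigma>s)"
  by (induction \<sigma>s g rule: dsum_rep.induct) (auto simp: dsum_dim_def)

lemma dsum_rep_unitary:
  "(\<And>\<rho> d. (\<rho>, d) \<in> set \<sigma>s \<Longrightarrow> unitary_mat d (\<rho> g)) \<Longrightarrow> unitary_mat (dsum_dim \<sigma>s) (dsum_rep \<sigma>s g)"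
proof (induction \<sigma>s g rule: dsum_rep.induct)
  case (1 g)
  have "mat_adjoint (0\<^sub>m 0 0 :: complex mat) \<in> carrier_mat 0 0"
    by (rule mat_adjoint_carrier) simp
  then show ?case by (auto simp: unitary_mat_def dsum_dim_def intro!: eq_matI)
next
  case (2 \<rho> d rs g)
  let ?m = "sum_list (map snd rs)"
  have 1: "\<rho> g \<in> carrier_mat d d" "mat_adjoint (\<rho> g) * \<rho> g = 1\<^sub>m d"
    using 2(2)[of \<rho> d] by (auto simp: unitary_mat_def)
  have 3: "dsum_rep rs g \<in> carrier_mat ?m ?m" "mat_adjoint (dsum_rep rs g) * dsum_rep rs g = 1\<^sub>m ?m"
    using 2 by (auto simp: unitary_mat_def dsum_dim_def)
  show ?case
    using 1 3 mat_adjoint_carrier[OF 1(1)] mat_adjoint_carrier[OF 3(1)]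
    by (simp add: unitary_mat_def dsum_dim_def mat_adjoint_four_block_diag mult_four_block_diag)
qed

lemma dsum_rep_mult:
  assumes "\<And>\<rho> d. (\<rho>, d) \<in> set \<sigma>s \<Longrightarrow>
    \<rho> g \<in> carrier_mat d d \<and> \<rho> h \<in> carrier_mat d d \<and> \<rho> (g * h) = \<rho> g * \<rho> h"
  shows "dsum_rep \<sigma>s (g * h) = dsum_rep \<sigma>s g * dsum_rep \<sigma>s h"
  using assms
proof (induction \<sigma>s)
  case Nil
  show ?case by (auto intro!: eq_matI)
next
  case (Cons p rs)
  obtain \<rho> d where p: "p = (\<rho>, d)" by force
  let ?m = "sum_list (map snd rs)"
  have 1: "\<rho> g \<in> carrier_mat d d" "\<rho> h \<in> carrier_mat d d" "\<rho> (g * h) = \<rho> g * \<rho> h"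
    using Cons.prems[of \<rho> d] p by auto
  have 2: "dsum_rep rs g \<in> carrier_mat ?m ?m" "dsum_rep rs h \<in> carrier_mat ?m ?m"
    using dsum_rep_carrier[of rs g] dsum_rep_carrier[of rs h] Cons.prems by (auto simp: dsum_dim_def)
  have 3: "dsum_rep rs (g * h) = dsum_rep rs g * dsum_rep rs h"
    using Cons by auto
  show ?case
    unfolding p using 1 2 3 by (simp add: mult_four_block_diag)
qed

lemma dsum_rep_one:
  "(\<And>\<rho> d. (\<rho>, d) \<in> set \<sigma>s \<Longrightarrow> \<rho> e = 1\<^sub>m d) \<Longrightarrow> dsum_rep \<sigma>s e = 1\<^sub>m (dsum_dim \<sigma>s)"
proof (induction \<sigma>s e rule: dsum_rep.induct)
  case (1 g)
  show ?case by (auto simp: dsum_dim_def intro!: eq_matI)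
next
  case (2 \<rho> d rs g)
  then have "\<rho> g = 1\<^sub>m d" "dsum_rep rs g = 1\<^sub>m (dsum_dim rs)" by auto
  then show ?case by (simp add: dsum_dim_def)
qed

section \<open>Representations of the maximal subgroup\<close>

context finite_idempotent
begin

section \<open>Equivalence of representations and Schur's lemma\<close>

lemma is_mat_repD:
  assumes "is_mat_rep e d \<rho>"
  shows "g \<in> Hgroup e \<Longrightarrow> \<rho> g \<in> carrier_mat d d"
    and "g \<in> Hgroup e \<Longrightarrow> h \<in> Hgroup e \<Longrightarrow> \<rho> (g * h) = \<rho> g * \<rho> h"
    and "\<rho> e = 1\<^sub>m d"
  using assms by (auto simp: is_mat_rep_def)

lemma irreducible_repD:
  assumes "irreducible_rep e d \<rho>"
  shows "is_mat_rep e d \<rho>" and "d > 0"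
    and "is_subspace d W \<Longrightarrow> (\<And>g w. g \<in> Hgroup e \<Longrightarrow> w \<in> W \<Longrightarrow> \<rho> g *\<^sub>v w \<in> W) \<Longrightarrow>
      W = {0\<^sub>v d} \<or> W = carrier_vec d"
  using assms unfolding irreducible_rep_def by blast+

lemma equiv_rep_sym:
  assumes \<rho>: "is_mat_rep e d \<rho>" and \<rho>': "is_mat_rep e d' \<rho>'" and eq: "equiv_rep e d \<rho> d' \<rho>'"
  shows "equiv_rep e d' \<rho>' d \<rho>"
proof -
  obtain P where d: "d = d'" and P: "P \<in> carrier_mat d d" "invertible_mat P"
    and int: "\<And>g. g \<in> Hgroup e \<Longrightarrow> P * \<rho> g = \<rho>' g * P"
    using eq by (auto simp: equiv_rep_def)
  obtain Q where Q: "Q \<in> carrier_mat d d" "P * Q = 1\<^sub>m d" "Q * P = 1\<^sub>m d"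
    using invertible_matE[OF P] .
  have "Q * \<rho>' g = \<rho> g * Q" if g: "g \<in> Hgroup e" for g
  proof -
    have c: "\<rho> g \<in> carrier_mat d d" "\<rho>' g \<in> carrier_mat d d"
      using is_mat_repD(1)[OF \<rho> g] is_mat_repD(1)[OF \<rho>' g] d by auto
    have "Q * \<rho>' g = Q * (\<rho>' g * P) * Q"
      using Q P c by (simp add: assoc_mult_mat[of _ d d _ d _ d])
    also have "\<dots> = (Q * P) * \<rho> g * Q"
      using Q(1) P(1) c by (simp add: int[OF g, symmetric] assoc_mult_mat[of _ d d _ d _ d])
    also have "\<dots> = \<rho> g * Q"
      using Q c by simp
    finally show ?thesis .
  qed
  moreover have "invertible_mat Q" using invertible_matI[OF Q(1) P(1) Q(3) Q(2)] .
  ultimately show ?thesis using d Q(1) unfolding equiv_rep_def by auto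
qed

lemma equiv_rep_trans:
  assumes \<rho>: "is_mat_rep e d \<rho>" and \<rho>': "is_mat_rep e d' \<rho>'" and \<rho>'': "is_mat_rep e d'' \<rho>''"
    and eq: "equiv_rep e d \<rho> d' \<rho>'" and eq': "equiv_rep e d' \<rho>' d'' \<rho>''"
  shows "equiv_rep e d \<rho> d'' \<rho>''"
proof -
  obtain P where d: "d = d'" and P: "P \<in> carrier_mat d d" "invertible_mat P"
    and int: "\<And>g. g \<in> Hgroup e \<Longrightarrow> P * \<rho> g = \<rho>' g * P"
    using eq by (auto simp: equiv_rep_def)
  obtain Q where Q: "Q \<in> carrier_mat d d" "P * Q = 1\<^sub>m d" "Q * P = 1\<^sub>m d"
    using invertible_matE[OF P] .
  obtain P' where d': "d' = d''" and P': "P' \<in> carrier_mat d d" "invertible_mat P'"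
    and int': "\<And>g. g \<in> Hgroup e \<Longrightarrow> P' * \<rho>' g = \<rho>'' g * P'"
    using eq' d by (auto simp: equiv_rep_def)
  obtain Q' where Q': "Q' \<in> carrier_mat d d" "P' * Q' = 1\<^sub>m d" "Q' * P' = 1\<^sub>m d"
    using invertible_matE[OF P'] .
  have inv: "invertible_mat (P' * P)"
  proof (rule invertible_matI[where Q = "Q * Q'"])
    have "(P' * P) * (Q * Q') = P' * (P * Q) * Q'"
      using P(1) P'(1) Q(1) Q'(1) by (simp add: assoc_mult_mat[of _ d d _ d _ d])
    then show "(P' * P) * (Q * Q') = 1\<^sub>m d" using P' Q Q' by simp
    have "(Q * Q') * (P' * P) = Q * (Q' * P') * P"
      using P(1) P'(1) Q(1) Q'(1) by (simp add: assoc_mult_mat[of _ d d _ d _ d])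
    then show "(Q * Q') * (P' * P) = 1\<^sub>m d" using P Q Q' by simp
  qed (use P P' Q Q' in auto)
  have "(P' * P) * \<rho> g = \<rho>'' g * (P' * P)" if g: "g \<in> Hgroup e" for g
  proof -
    have c: "\<rho> g \<in> carrier_mat d d" "\<rho>' g \<in> carrier_mat d d" "\<rho>'' g \<in> carrier_mat d d"
      using is_mat_repD(1)[OF \<rho> g] is_mat_repD(1)[OF \<rho>' g] is_mat_repD(1)[OF \<rho>'' g] d d' by auto
    have "(P' * P) * \<rho> g = P' * (P * \<rho> g)"
      using P(1) P'(1) c by (simp add: assoc_mult_mat[of _ d d _ d _ d])
    also have "\<dots> = (P' * \<rho>' g) * P"
      using P(1) P'(1) c by (simp add: int[OF g] assoc_mult_mat[of _ d d _ d _ d])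
    also have "\<dots> = \<rho>'' g * (P' * P)"
      using P(1) P'(1) c by (simp add: int'[OF g] assoc_mult_mat[of _ d d _ d _ d])
    finally show ?thesis .
  qed
  then show ?thesis
    using d d' inv P(1) P'(1) unfolding equiv_rep_def by (intro conjI bexI[of _ "P' * P"]) auto
qed

text \<open>Schur's lemma: the kernel and the image of an intertwiner are invariant subspaces. As
  \<open>T\<close> is nonzero, irreducibility makes the kernel trivial and the image the whole
  space, so \<open>T\<close> is an isomorphism.\<close>

lemma schur_intertwiner:
  assumes \<rho>: "irreducible_rep e d \<rho>" and \<rho>': "irreducible_rep e d' \<rho>'"
    and T: "T \<in> carrier_mat d' d" and int: "\<And>g. g \<in> Hgroup e \<Longrightarrow> T * \<rho> g = \<rho>' g * T"
    and nz: "T \<noteq> 0\<^sub>m d' d"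
  shows "equiv_rep e d \<rho> d' \<rho>'"
proof -
  note r = is_mat_repD(1)[OF irreducible_repD(1)[OF \<rho>]]
  note r' = is_mat_repD(1)[OF irreducible_repD(1)[OF \<rho>']]
  have act: "T *\<^sub>v (\<rho> g *\<^sub>v v) = \<rho>' g *\<^sub>v (T *\<^sub>v v)" if "g \<in> Hgroup e" "v \<in> carrier_vec d" for g v
  proof -
    have "T *\<^sub>v (\<rho> g *\<^sub>v v) = (T * \<rho> g) *\<^sub>v v" using assoc_mult_mat_vec[OF T r[OF that(1)] that(2)] by simp
    also have "\<dots> = \<rho>' g *\<^sub>v (T *\<^sub>v v)" unfolding int[OF that(1)]
      using assoc_mult_mat_vec[OF r'[OF that(1)] T that(2)] by simp
    finally show ?thesis .
  qed
  have T0: "\<exists>v\<in>carrier_vec d. T *\<^sub>v v \<noteq> 0\<^sub>v d'"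
  proof (rule ccontr)
    assume "\<not> (\<exists>v\<in>carrier_vec d. T *\<^sub>v v \<noteq> 0\<^sub>v d')"
    then have "T *\<^sub>v v = 0\<^sub>m d' d *\<^sub>v v" if "v \<in> carrier_vec d" for v
      using that by (auto intro!: eq_vecI)
    then show False using mat_eq_if_mult_vec_eq[OF T zero_carrier_mat] nz by blast
  qed
  define K where "K = {v \<in> carrier_vec d. T *\<^sub>v v = 0\<^sub>v d'}"
  have "is_subspace d K"
    using T by (auto simp: is_subspace_def K_def mult_add_distrib_mat_vec[OF T] mult_mat_vec[OF T])
  moreover have "\<rho> g *\<^sub>v w \<in> K" if "g \<in> Hgroup e" "w \<in> K" for g w
    using that r[OF that(1)] r'[OF that(1)] act[OF that(1), of w] by (auto simp: K_def)
  ultimately have "K = {0\<^sub>v d} \<or> K = carrier_vec d"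
    by (rule irreducible_repD(3)[OF \<rho>])
  moreover have "K \<noteq> carrier_vec d" using T0 by (auto simp: K_def)
  ultimately have K: "K = {0\<^sub>v d}" by simp
  define I where "I = (\<lambda>v. T *\<^sub>v v) ` carrier_vec d"
  have "is_subspace d' I"
    unfolding is_subspace_def
  proof (intro conjI ballI allI)
    show "I \<subseteq> carrier_vec d'" using T by (auto simp: I_def)
    have "T *\<^sub>v 0\<^sub>v d = 0\<^sub>v d'" using T by auto
    then show "0\<^sub>v d' \<in> I" unfolding I_def by (metis imageI zero_carrier_vec)
  next
    fix v w assume "v \<in> I" "w \<in> I"
    then obtain a b where "a \<in> carrier_vec d" "b \<in> carrier_vec d" "v = T *\<^sub>v a" "w = T *\<^sub>v b"
      by (auto simp: I_def)
    then show "v + w \<in> I"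
      unfolding I_def by (intro image_eqI[of _ _ "a + b"]) (auto simp: mult_add_distrib_mat_vec[OF T])
  next
    fix c v assume "v \<in> I"
    then obtain a where "a \<in> carrier_vec d" "v = T *\<^sub>v a"
      by (auto simp: I_def)
    then show "c \<cdot>\<^sub>v v \<in> I"
      unfolding I_def by (intro image_eqI[of _ _ "c \<cdot>\<^sub>v a"]) (auto simp: mult_mat_vec[OF T])
  qed
  moreover have "\<rho>' g *\<^sub>v w \<in> I" if "g \<in> Hgroup e" "w \<in> I" for g w
  proof -
    obtain a where "a \<in> carrier_vec d" "w = T *\<^sub>v a" using \<open>w \<in> I\<close> by (auto simp: I_def)
    then show ?thesis
      unfolding I_def using act[OF that(1), of a] r[OF that(1)] by (intro image_eqI[of _ _ "\<rho> g *\<^sub>v a"]) auto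
  qed
  ultimately have "I = {0\<^sub>v d'} \<or> I = carrier_vec d'"
    by (rule irreducible_repD(3)[OF \<rho>'])
  moreover have "I \<noteq> {0\<^sub>v d'}" using T0 by (auto simp: I_def)
  ultimately have I: "I = carrier_vec d'" by simp
  have "\<exists>s. s \<in> carrier_vec d \<and> T *\<^sub>v s = unit_vec d' i" for i
    using I unit_vec_carrier[of d' i] unfolding I_def by (metis (no_types, lifting) imageE)
  then obtain s where s: "\<And>i. s i \<in> carrier_vec d" "\<And>i. T *\<^sub>v s i = unit_vec d' i" by metis
  \<comment> \<open>The columns of \<open>S\<close> are preimages of the standard basis, so
    \<open>S\<close> is a right inverse of \<open>T\<close>.\<close>
  define S where "S = mat d d' (\<lambda>(k, i). s i $ k)"
  have S: "S \<in> carrier_mat d d'" by (simp add: S_def)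
  have TS: "T * S = 1\<^sub>m d'"
  proof (rule eq_matI)
    fix i j assume "i < dim_row (1\<^sub>m d' :: complex mat)" "j < dim_col (1\<^sub>m d' :: complex mat)"
    then have ij: "i < d'" "j < d'" by auto
    have "col S j = s j" using s(1)[of j] ij by (intro eq_vecI) (auto simp: S_def)
    then have "(T * S) $$ (i, j) = (T *\<^sub>v s j) $ i" using ij T S by simp
    then show "(T * S) $$ (i, j) = 1\<^sub>m d' $$ (i, j)" using ij s(2) by (auto simp: unit_vec_def)
  qed (use T S in auto)
  have ST: "S * T = 1\<^sub>m d"
  proof (rule mat_eq_if_mult_vec_eq)
    fix v :: "complex vec" assume v: "v \<in> carrier_vec d"
    have STv: "(S * T) *\<^sub>v v = S *\<^sub>v (T *\<^sub>v v)" "S *\<^sub>v (T *\<^sub>v v) \<in> carrier_vec d" using S T v by auto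
    \<comment> \<open>\<open>T\<close> kills the difference of \<open>S T v\<close> and
      \<open>v\<close>; injectivity of \<open>T\<close> makes \<open>S\<close> a left inverse as
      well.\<close>
    have "T *\<^sub>v (S *\<^sub>v (T *\<^sub>v v) - v) = T *\<^sub>v (S *\<^sub>v (T *\<^sub>v v)) - T *\<^sub>v v"
      using mult_minus_distrib_mat_vec[OF T STv(2) v] .
    also have "T *\<^sub>v (S *\<^sub>v (T *\<^sub>v v)) = (T * S) *\<^sub>v (T *\<^sub>v v)"
      using T S v by simp
    also have "\<dots> = T *\<^sub>v v" unfolding TS using T v by simp
    finally have "T *\<^sub>v (S *\<^sub>v (T *\<^sub>v v) - v) = 0\<^sub>v d'" using T v by auto
    then have "S *\<^sub>v (T *\<^sub>v v) - v \<in> K" using STv v by (auto simp: K_def)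
    then have 0: "S *\<^sub>v (T *\<^sub>v v) - v = 0\<^sub>v d" using K by simp
    have "S *\<^sub>v (T *\<^sub>v v) = v"
    proof (rule eq_vecI)
      fix i assume "i < dim_vec v"
      then show "(S *\<^sub>v (T *\<^sub>v v)) $ i = v $ i"
        using arg_cong[OF 0, of "\<lambda>w. w $ i"] v by auto
    qed (use S v in auto)
    then show "(S * T) *\<^sub>v v = 1\<^sub>m d *\<^sub>v v" using STv v by simp
  qed (use S T in auto)
  have d: "d' = d" using two_sided_inverse_square[OF T S TS ST] .
  have "invertible_mat T" using invertible_matI[of T d S] T S TS ST d by simp
  then show ?thesis using T d int unfolding equiv_rep_def by blast
qed


section \<open>Averaging over G_e and unitary representations\<close>

text \<open>The unnormalised average of \<open>M\<close> over G_e. For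
  \<open>\<sigma> = \<tau>\<close> and \<open>M\<close> the identity it is Weyl's invariant
  Hermitian form; for unitary \<open>\<sigma>\<close> it is an intertwiner from
  \<open>\<tau>\<close> to \<open>\<sigma>\<close>.\<close>

definition group_sum :: "nat \<Rightarrow> nat \<Rightarrow> ('a \<Rightarrow> complex mat) \<Rightarrow> ('a \<Rightarrow> complex mat) \<Rightarrow> complex mat \<Rightarrow> complex mat" where
  "group_sum d d' \<sigma> \<tau> M =
    mat d d' (\<lambda>(i, j). \<Sum>g\<in>Hgroup e. (mat_adjoint (\<sigma> g) * M * \<tau> g) $$ (i, j))"

lemma group_sum_carrier: "group_sum d d' \<sigma> \<tau> M \<in> carrier_mat d d'"
  by (simp add: group_sum_def)

text \<open>Multiplying the summand at \<open>g\<close> by \<open>\<sigma>(h)^*\<close> on the left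
  and \<open>\<tau>(h)\<close> on the right gives the summand at \<open>g * h\<close>, and
  \<open>g * h\<close> runs through the group again.\<close>

lemma group_sum_invariant:
  assumes \<sigma>: "is_mat_rep e d \<sigma>" and \<tau>: "is_mat_rep e d' \<tau>" and M: "M \<in> carrier_mat d d'"
    and h: "h \<in> Hgroup e"
  shows "mat_adjoint (\<sigma> h) * group_sum d d' \<sigma> \<tau> M * \<tau> h = group_sum d d' \<sigma> \<tau> M"
proof (rule eq_matI)
  let ?S = "group_sum d d' \<sigma> \<tau> M"
  note s = is_mat_repD[OF \<sigma>] and t = is_mat_repD[OF \<tau>]
  note S = group_sum_carrier[of d d' \<sigma> \<tau> M]
  define A where "A = mat_adjoint (\<sigma> h)"
  define B where "B = \<tau> h"
  define X where "X g = mat_adjoint (\<sigma> g) * M * \<tau> g" for g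
  have A: "A \<in> carrier_mat d d" and B: "B \<in> carrier_mat d' d'"
    using mat_adjoint_carrier[OF s(1)[OF h]] t(1)[OF h] by (auto simp: A_def B_def)
  have X: "X g \<in> carrier_mat d d'" if "g \<in> Hgroup e" for g
    using mat_adjoint_carrier[OF s(1)[OF that]] t(1)[OF that] M by (auto simp: X_def)
  have AXB: "A * X g * B = X (g * h)" if g: "g \<in> Hgroup e" for g
  proof -
    note s' = mat_adjoint_carrier[OF s(1)[OF g]] and t' = t(1)[OF g]
    have "X (g * h) = (A * mat_adjoint (\<sigma> g)) * M * (\<tau> g * B)"
      unfolding X_def A_def B_def s(2)[OF g h] t(2)[OF g h]
      by (simp add: mat_adjoint_mult[OF s(1)[OF g] s(1)[OF h]])
    also have "\<dots> = A * X g * B"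
      unfolding X_def using A B M s' t'
      by (simp add: assoc_mult_mat[of _ d d _ d' _ d'] assoc_mult_mat[of _ d d _ d _ d'])
    finally show ?thesis by simp
  qed
  have entry: "(A * Y * B) $$ (i, j) = (\<Sum>l<d'. \<Sum>k<d. A $$ (i, k) * Y $$ (k, l) * B $$ (l, j))"
    if Y: "Y \<in> carrier_mat d d'" and ij: "i < d" "j < d'" for Y i j
    unfolding mult_mat_index[OF mult_carrier_mat[OF A Y] B ij]
    by (intro sum.cong refl) (simp add: mult_mat_index[OF A Y ij(1)] sum_distrib_right del: index_mult_mat)
  fix i j assume "i < dim_row ?S" "j < dim_col ?S"
  then have ij: "i < d" "j < d'" using S by auto
  have "(A * ?S * B) $$ (i, j) = (\<Sum>l<d'. \<Sum>k<d. \<Sum>g\<in>Hgroup e. A $$ (i, k) * X g $$ (k, l) * B $$ (l, j))"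
    unfolding entry[OF S ij]
    by (intro sum.cong refl) (simp add: group_sum_def X_def sum_distrib_left sum_distrib_right)
  also have "\<dots> = (\<Sum>g\<in>Hgroup e. \<Sum>l<d'. \<Sum>k<d. A $$ (i, k) * X g $$ (k, l) * B $$ (l, j))"
    by (rule sum_rotate)
  also have "\<dots> = (\<Sum>g\<in>Hgroup e. (A * X g * B) $$ (i, j))"
    by (intro sum.cong refl) (simp add: entry[OF X ij] del: index_mult_mat)
  also have "\<dots> = (\<Sum>g\<in>Hgroup e. X (g * h) $$ (i, j))"
    by (intro sum.cong refl) (simp add: AXB)
  also have "\<dots> = (\<Sum>g\<in>Hgroup e. X g $$ (i, j))"
    by (rule sum.reindex_bij_betw[OF Hgroup_bij_mult_right[OF h], of "\<lambda>g. X g $$ (i, j)"])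
  also have "\<dots> = ?S $$ (i, j)"
    using ij by (simp add: group_sum_def X_def)
  finally show "(mat_adjoint (\<sigma> h) * ?S * \<tau> h) $$ (i, j) = ?S $$ (i, j)"
    by (simp only: A_def B_def)
qed (use group_sum_carrier mat_adjoint_carrier[OF is_mat_repD(1)[OF \<sigma> h]] is_mat_repD(1)[OF \<tau> h] in
    \<open>auto simp: group_sum_def\<close>)

text \<open>Weyl's averaging: the invariant form factors as \<open>H = P^* P\<close>, and
  conjugation by \<open>P\<close> carries it to the standard form, for which the representation is
  then unitary.\<close>

lemma unitarize:
  assumes \<rho>: "is_mat_rep e d \<rho>"
  obtains P Q where "P \<in> carrier_mat d d" "Q \<in> carrier_mat d d" "P * Q = 1\<^sub>m d" "Q * P = 1\<^sub>m d"
    "\<And>g. g \<in> Hgroup e \<Longrightarrow> unitary_mat d (P * \<rho> g * Q)"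
proof -
  note r = is_mat_repD[OF \<rho>]
  define H where "H = group_sum d d \<rho> \<rho> (1\<^sub>m d)"
  have H: "H \<in> carrier_mat d d" by (simp add: H_def group_sum_carrier)
  have H_index: "H $$ (i, j) = (\<Sum>g\<in>Hgroup e. \<Sum>k<d. cnj (\<rho> g $$ (k, i)) * \<rho> g $$ (k, j))"
    if ij: "i < d" "j < d" for i j
  proof -
    have "(mat_adjoint (\<rho> g) * 1\<^sub>m d * \<rho> g) $$ (i, j) = (\<Sum>k<d. cnj (\<rho> g $$ (k, i)) * \<rho> g $$ (k, j))"
      if g: "g \<in> Hgroup e" for g
      using ij mat_adjoint_carrier[OF r(1)[OF g]]
      by (simp add: mult_mat_index[OF mat_adjoint_carrier[OF r(1)[OF g]] r(1)[OF g]]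
          mat_adjoint_index[OF r(1)[OF g]] del: index_mult_mat)
    then show ?thesis using ij by (simp add: H_def group_sum_def del: index_mult_mat)
  qed
  have herm: "H $$ (j, i) = cnj (H $$ (i, j))" if "i < d" "j < d" for i j
    using that by (simp add: H_index mult.commute)
  have pos: "0 < Re (\<Sum>i<d. \<Sum>j<d. cnj (v i) * H $$ (i, j) * v j)" if v: "\<exists>i<d. v i \<noteq> 0" for v
  proof -
    \<comment> \<open>\<open>w g\<close> is the image of \<open>v\<close> under
      \<open>\<rho> g\<close>, so the form is a sum of squared norms; the summand at
      \<open>e\<close> is positive because \<open>\<rho> e\<close> is the identity.\<close>
    define w where "w g k = (\<Sum>j<d. \<rho> g $$ (k, j) * v j)" for g k
    have "(\<Sum>i<d. \<Sum>j<d. cnj (v i) * H $$ (i, j) * v j) =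
        (\<Sum>i<d. \<Sum>j<d. \<Sum>g\<in>Hgroup e. \<Sum>k<d. cnj (\<rho> g $$ (k, i) * v i) * (\<rho> g $$ (k, j) * v j))"
      by (intro sum.cong refl) (simp add: H_index sum_distrib_left sum_distrib_right mult_ac)
    also have "\<dots> = (\<Sum>g\<in>Hgroup e. \<Sum>k<d. \<Sum>i<d. \<Sum>j<d. cnj (\<rho> g $$ (k, i) * v i) * (\<rho> g $$ (k, j) * v j))"
      by (rule trans[OF sum_rotate sum.cong[OF refl sum_rotate]])
    also have "\<dots> = (\<Sum>g\<in>Hgroup e. \<Sum>k<d. cnj (w g k) * w g k)"
      by (simp add: w_def sum_product)
    also have "\<dots> = of_real (\<Sum>g\<in>Hgroup e. \<Sum>k<d. (cmod (w g k))\<^sup>2)"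
      by (simp only: of_real_sum complex_norm_square mult.commute)
    finally have eq: "Re (\<Sum>i<d. \<Sum>j<d. cnj (v i) * H $$ (i, j) * v j) = (\<Sum>g\<in>Hgroup e. \<Sum>k<d. (cmod (w g k))\<^sup>2)"
      by simp
    obtain i where i: "i < d" "v i \<noteq> 0" using v by blast
    have "w e i = (\<Sum>j<d. if j = i then v i else 0)"
      unfolding w_def r(3) using i by (intro sum.cong) auto
    then have "w e i \<noteq> 0" using i by simp
    then have "0 < (cmod (w e i))\<^sup>2" by simp
    also have "\<dots> \<le> (\<Sum>k<d. (cmod (w e k))\<^sup>2)"
      using i by (intro member_le_sum) auto
    also have "\<dots> \<le> (\<Sum>g\<in>Hgroup e. \<Sum>k<d. (cmod (w g k))\<^sup>2)"
      using e_in_Hgroup by (intro member_le_sum[of e _ "\<lambda>g. \<Sum>k<d. (cmod (w g k))\<^sup>2"]) (auto intro: sum_nonneg)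
    finally show ?thesis unfolding eq .
  qed
  obtain C where C: "\<And>i j. i < d \<Longrightarrow> j < d \<Longrightarrow> (\<Sum>k<d. cnj (C k i) * C k j) = H $$ (i, j)"
    using cholesky_factor[of d "\<lambda>i j. H $$ (i, j)", OF herm pos] by blast
  define P where "P = mat d d (\<lambda>(i, j). C i j)"
  have P: "P \<in> carrier_mat d d" by (simp add: P_def)
  note P' = mat_adjoint_carrier[OF P]
  have PP: "mat_adjoint P * P = H"
  proof (rule eq_matI)
    fix i j assume "i < dim_row H" "j < dim_col H"
    then have ij: "i < d" "j < d" using H by auto
    show "(mat_adjoint P * P) $$ (i, j) = H $$ (i, j)"
      unfolding mult_mat_index[OF P' P ij] C[OF ij, symmetric]
      using ij by (intro sum.cong refl) (auto simp: mat_adjoint_index[OF P], simp add: P_def)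
  qed (use P P' H in auto)
  \<comment> \<open>A kernel vector of \<open>P\<close> is one of \<open>H\<close> too, which
    contradicts definiteness.\<close>
  have "det P \<noteq> 0"
  proof
    assume "det P = 0"
    then obtain v where v: "v \<in> carrier_vec d" "v \<noteq> 0\<^sub>v d" "P *\<^sub>v v = 0\<^sub>v d"
      using det_0_iff_vec_prod_zero[OF P] by blast
    have "H *\<^sub>v v = mat_adjoint P *\<^sub>v (P *\<^sub>v v)"
      unfolding PP[symmetric] using P P' v by simp
    then have Hv: "H *\<^sub>v v = 0\<^sub>v d" unfolding v(3) using P' by auto
    have "(\<Sum>j<d. H $$ (i, j) * v $ j) = 0" if "i < d" for i
    proof -
      have "(H *\<^sub>v v) $ i = (\<Sum>j<d. H $$ (i, j) * v $ j)"
        using that H v(1) by (simp add: scalar_prod_def atLeast0LessThan)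
      then show ?thesis using Hv that by simp
    qed
    then have "(\<Sum>i<d. \<Sum>j<d. cnj (v $ i) * H $$ (i, j) * v $ j) = 0"
      by (simp add: mult.assoc sum_distrib_left[symmetric])
    moreover have "\<exists>i<d. v $ i \<noteq> 0"
      using v(1,2) eq_vecI[of v "0\<^sub>v d"] by auto
    ultimately show False using pos[of "\<lambda>i. v $ i"] by simp
  qed
  then have "P \<in> Units (ring_mat TYPE(complex) d ())"
    by (rule det_non_zero_imp_unit[OF P])
  then obtain Q where Q: "Q \<in> carrier_mat d d" "P * Q = 1\<^sub>m d" "Q * P = 1\<^sub>m d"
    unfolding Units_def ring_mat_def by auto
  note Q' = mat_adjoint_carrier[OF Q(1)]
  have "unitary_mat d (P * \<rho> g * Q)" if g: "g \<in> Hgroup e" for g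
  proof -
    let ?R = "\<rho> g"
    note R = r(1)[OF g] and R' = mat_adjoint_carrier[OF r(1)[OF g]]
    note assoc = assoc_mult_mat[of _ d d _ d _ d]
    have "mat_adjoint (P * ?R * Q) = mat_adjoint Q * (mat_adjoint ?R * mat_adjoint P)"
      by (simp add: mat_adjoint_mult[OF mult_carrier_mat[OF P R] Q(1)] mat_adjoint_mult[OF P R])
    \<comment> \<open>Regrouping exposes \<open>\<rho>(g)^* H \<rho>(g)\<close>, which invariance
      replaces by \<open>H = P^* P\<close>; what is left cancels against \<open>Q\<close>.\<close>
    then have "mat_adjoint (P * ?R * Q) * (P * ?R * Q) =
        mat_adjoint Q * (mat_adjoint ?R * (mat_adjoint P * P) * ?R) * Q"
      using P P' Q(1) Q' R R' by (simp add: assoc)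
    also have "\<dots> = mat_adjoint Q * (mat_adjoint P * P) * Q"
      unfolding PP unfolding H_def group_sum_invariant[OF \<rho> \<rho> one_carrier_mat g] ..
    also have "\<dots> = mat_adjoint (P * Q) * (P * Q)"
      using P P' Q(1) Q' by (simp add: mat_adjoint_mult[OF P Q(1)] assoc)
    also have "\<dots> = 1\<^sub>m d" using Q(2) by (simp add: mat_adjoint_one)
    finally show ?thesis
      using P Q(1) R by (simp add: unitary_mat_def)
  qed
  with that P Q show ?thesis by blast
qed


lemma equiv_rep_conj:
  assumes \<rho>: "is_mat_rep e d \<rho>"
    and P: "P \<in> carrier_mat d d" and Q: "Q \<in> carrier_mat d d" and PQ: "P * Q = 1\<^sub>m d" and QP: "Q * P = 1\<^sub>m d"
  shows "equiv_rep e d \<rho> d (\<lambda>g. P * \<rho> g * Q)"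
proof -
  have "P * \<rho> g = P * \<rho> g * Q * P" if g: "g \<in> Hgroup e" for g
  proof -
    have R: "P * \<rho> g \<in> carrier_mat d d" using P is_mat_repD(1)[OF \<rho> g] by simp
    have "P * \<rho> g * Q * P = P * \<rho> g * (Q * P)" using assoc_mult_mat[OF R Q P] .
    then show ?thesis unfolding QP right_mult_one_mat[OF R] by simp
  qed
  then show ?thesis
    using P invertible_matI[OF P Q PQ QP] unfolding equiv_rep_def by blast
qed

text \<open>An invariant subspace \<open>W\<close> of the conjugate pulls back along
  \<open>P\<close> to an invariant subspace \<open>V\<close> of \<open>\<rho>\<close>, and
  \<open>W\<close> is recovered from \<open>V\<close> since \<open>P\<close> is bijective.\<close>

lemma irreducible_rep_conj:
  assumes \<rho>: "irreducible_rep e d \<rho>"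
    and P: "P \<in> carrier_mat d d" and Q: "Q \<in> carrier_mat d d" and PQ: "P * Q = 1\<^sub>m d" and QP: "Q * P = 1\<^sub>m d"
  shows "irreducible_rep e d (\<lambda>g. P * \<rho> g * Q)"
proof -
  note r = is_mat_repD[OF irreducible_repD(1)[OF \<rho>]]
  have int: "(P * \<rho> g * Q) * P = P * \<rho> g" if g: "g \<in> Hgroup e" for g
  proof -
    have R: "P * \<rho> g \<in> carrier_mat d d" using P r(1)[OF g] by simp
    have "P * \<rho> g * Q * P = P * \<rho> g * (Q * P)" using assoc_mult_mat[OF R Q P] .
    then show ?thesis unfolding QP right_mult_one_mat[OF R] by simp
  qed
  have rep: "is_mat_rep e d (\<lambda>g. P * \<rho> g * Q)"
    unfolding is_mat_rep_def
  proof (intro conjI ballI)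
    show "P * \<rho> g * Q \<in> carrier_mat d d" if "g \<in> Hgroup e" for g
      using P Q r(1)[OF that] by simp
    show "P * \<rho> e * Q = 1\<^sub>m d" using P PQ r(3) by simp
    fix g h assume g: "g \<in> Hgroup e" and h: "h \<in> Hgroup e"
    note rg = r(1)[OF g] and rh = r(1)[OF h]
    have "P * \<rho> g * Q * (P * \<rho> h * Q) = (P * \<rho> g * Q) * P * (\<rho> h * Q)"
      using P Q rg rh by (simp add: assoc_mult_mat[of _ d d _ d _ d])
    also have "\<dots> = P * \<rho> (g * h) * Q"
      unfolding int[OF g] r(2)[OF g h] using P Q rg rh by (simp add: assoc_mult_mat[of _ d d _ d _ d])
    finally show "P * \<rho> (g * h) * Q = P * \<rho> g * Q * (P * \<rho> h * Q)" by simp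
  qed
  have "W = {0\<^sub>v d} \<or> W = carrier_vec d"
    if W: "is_subspace d W" and inv: "\<And>g w. g \<in> Hgroup e \<Longrightarrow> w \<in> W \<Longrightarrow> (P * \<rho> g * Q) *\<^sub>v w \<in> W" for W
  proof -
    define V where "V = {v \<in> carrier_vec d. P *\<^sub>v v \<in> W}"
    have P0: "P *\<^sub>v 0\<^sub>v d = 0\<^sub>v d" using P by auto
    have "is_subspace d V"
      using W P0 by (auto simp: is_subspace_def V_def mult_add_distrib_mat_vec[OF P] mult_mat_vec[OF P])
    moreover have "\<rho> g *\<^sub>v v \<in> V" if g: "g \<in> Hgroup e" and v: "v \<in> V" for g v
    proof -
      have v': "v \<in> carrier_vec d" "P *\<^sub>v v \<in> W" using v by (auto simp: V_def)
      have "P *\<^sub>v (\<rho> g *\<^sub>v v) = (P * \<rho> g) *\<^sub>v v"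
        using assoc_mult_mat_vec[OF P r(1)[OF g] v'(1)] by simp
      also have "\<dots> = ((P * \<rho> g * Q) * P) *\<^sub>v v"
        by (simp only: int[OF g])
      also have "\<dots> = (P * \<rho> g * Q) *\<^sub>v (P *\<^sub>v v)"
        using P Q r(1)[OF g] v'(1)
        by (intro assoc_mult_mat_vec[of _ d d _ d]) auto
      finally show ?thesis
        using inv[OF g v'(2)] v'(1) r(1)[OF g] by (simp add: V_def)
    qed
    ultimately have V: "V = {0\<^sub>v d} \<or> V = carrier_vec d"
      by (rule irreducible_repD(3)[OF \<rho>])
    have Wc: "W \<subseteq> carrier_vec d" and W0: "0\<^sub>v d \<in> W" using W by (auto simp: is_subspace_def)
    have PQw: "P *\<^sub>v (Q *\<^sub>v w) = w" "Q *\<^sub>v w \<in> carrier_vec d" if "w \<in> carrier_vec d" for w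
      using assoc_mult_mat_vec[OF P Q that] PQ that Q by auto
    from V show ?thesis
    proof
      assume V0: "V = {0\<^sub>v d}"
      have "w = 0\<^sub>v d" if "w \<in> W" for w
      proof -
        have w: "w \<in> carrier_vec d" using that Wc by blast
        then have "Q *\<^sub>v w \<in> V" using PQw[OF w] that by (simp add: V_def)
        then have "Q *\<^sub>v w = 0\<^sub>v d" using V0 by blast
        then show ?thesis using PQw(1)[OF w] P0 by simp
      qed
      then show ?thesis using W0 by blast
    next
      assume V1: "V = carrier_vec d"
      have "w \<in> W" if w: "w \<in> carrier_vec d" for w
      proof -
        have "Q *\<^sub>v w \<in> V" using PQw(2)[OF w] V1 by blast
        then show ?thesis using PQw(1)[OF w] by (simp add: V_def)
      qed
      then show ?thesis using Wc by blast
    qed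
  qed
  then show ?thesis
    using rep irreducible_repD(2)[OF \<rho>] unfolding irreducible_rep_def by blast
qed

text \<open>Guarantees that a complete list of irreducible representations is nonempty, so that
  their sum has positive degree.\<close>

lemma trivial_rep_irreducible: "irreducible_rep e 1 (\<lambda>_. 1\<^sub>m 1)"
proof -
  have "W = {0\<^sub>v 1} \<or> W = carrier_vec 1" if W: "is_subspace 1 W" for W
  proof (cases "W = {0\<^sub>v 1}")
    case False
    then obtain w where w: "w \<in> W" "w \<noteq> 0\<^sub>v 1" using W by (auto simp: is_subspace_def)
    then have wc: "w \<in> carrier_vec 1" using W by (auto simp: is_subspace_def)
    have w0: "w $ 0 \<noteq> 0"
    proof
      assume "w $ 0 = 0"
      then have "w = 0\<^sub>v 1" using wc by (intro eq_vecI) auto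
      with w show False by simp
    qed
    have "v \<in> W" if v: "v \<in> carrier_vec 1" for v
    proof -
      have "v = (v $ 0 / w $ 0) \<cdot>\<^sub>v w" using v wc w0 by (intro eq_vecI) auto
      then show ?thesis using W w(1) unfolding is_subspace_def by metis
    qed
    then show ?thesis using W by (auto simp: is_subspace_def)
  qed simp
  then show ?thesis by (simp add: irreducible_rep_def is_mat_rep_def)
qed

section \<open>Orthogonality of matrix coefficients and completeness\<close>

text \<open>The candidate lists among which a longest one is taken; completeness is left out here
  and will follow from maximality.\<close>

definition inequivalent_unitary_irreps :: "(('a \<Rightarrow> complex mat) \<times> nat) list \<Rightarrow> bool" where
  "inequivalent_unitary_irreps \<sigma>s \<longleftrightarrow>
     (\<forall>k<length \<sigma>s. irreducible_rep e (snd (\<sigma>s ! k)) (fst (\<sigma>s ! k)) \<and>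
        (\<forall>g\<in>Hgroup e. unitary_mat (snd (\<sigma>s ! k)) (fst (\<sigma>s ! k) g))) \<and>
     (\<forall>k<length \<sigma>s. \<forall>l<length \<sigma>s. k \<noteq> l \<longrightarrow>
        \<not> equiv_rep e (snd (\<sigma>s ! k)) (fst (\<sigma>s ! k)) (snd (\<sigma>s ! l)) (fst (\<sigma>s ! l)))"

text \<open>Averaging the matrix unit at \<open>(0, 0)\<close> gives an intertwiner from
  \<open>\<tau>\<close> to \<open>\<sigma>\<close>, which vanishes by Schur's lemma; its
  \<open>(0, 0)\<close> entry is the sum in question.\<close>

lemma schur_orthogonality:
  assumes \<sigma>: "irreducible_rep e d \<sigma>" and \<tau>: "irreducible_rep e d' \<tau>"
    and unit: "\<And>g. g \<in> Hgroup e \<Longrightarrow> unitary_mat d (\<sigma> g)"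
    and ineq: "\<not> equiv_rep e d' \<tau> d \<sigma>"
  shows "(\<Sum>g\<in>Hgroup e. cnj (\<sigma> g $$ (0, 0)) * \<tau> g $$ (0, 0)) = 0"
proof -
  note s = is_mat_repD[OF irreducible_repD(1)[OF \<sigma>]] and t = is_mat_repD[OF irreducible_repD(1)[OF \<tau>]]
  have d: "0 < d" "0 < d'" using irreducible_repD(2) \<sigma> \<tau> by auto
  define M where "M = mat d d' (\<lambda>(i, j). if i = 0 \<and> j = 0 then 1 else 0 :: complex)"
  have M: "M \<in> carrier_mat d d'" by (simp add: M_def)
  let ?S = "group_sum d d' \<sigma> \<tau> M"
  note S = group_sum_carrier[of d d' \<sigma> \<tau> M]
  have "?S * \<tau> h = \<sigma> h * ?S" if h: "h \<in> Hgroup e" for h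
  proof -
    note sh = s(1)[OF h] and sh' = mat_adjoint_carrier[OF s(1)[OF h]] and th = t(1)[OF h]
    \<comment> \<open>Unitarity on the other side turns invariance under
      \<open>\<sigma>(h)^*\<close> into the intertwining relation.\<close>
    have "\<sigma> h * mat_adjoint (\<sigma> h) = 1\<^sub>m d"
      using mat_mult_left_right_inverse[OF sh' sh] unit[OF h] by (simp add: unitary_mat_def)
    then have "?S * \<tau> h = (\<sigma> h * mat_adjoint (\<sigma> h)) * (?S * \<tau> h)"
      using S th by simp
    also have "\<dots> = \<sigma> h * (mat_adjoint (\<sigma> h) * ?S * \<tau> h)"
      using S th sh sh' by (simp add: assoc_mult_mat[of _ d d _ d _ d'] assoc_mult_mat[of _ d d _ d' _ d'])
    also have "\<dots> = \<sigma> h * ?S"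
      using group_sum_invariant[OF irreducible_repD(1)[OF \<sigma>] irreducible_repD(1)[OF \<tau>] M h] by simp
    finally show ?thesis .
  qed
  then have "?S = 0\<^sub>m d d'"
    using schur_intertwiner[OF \<tau> \<sigma> S] ineq by blast
  then have "0 = ?S $$ (0, 0)" using d by simp
  also have "\<dots> = (\<Sum>g\<in>Hgroup e. (mat_adjoint (\<sigma> g) * M * \<tau> g) $$ (0, 0))"
    using d by (simp add: group_sum_def)
  also have "\<dots> = (\<Sum>g\<in>Hgroup e. cnj (\<sigma> g $$ (0, 0)) * \<tau> g $$ (0, 0))"
  proof (rule sum.cong[OF refl])
    fix g assume g: "g \<in> Hgroup e"
    note sg = s(1)[OF g] and sg' = mat_adjoint_carrier[OF s(1)[OF g]] and tg = t(1)[OF g]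
    have "(mat_adjoint (\<sigma> g) * M) $$ (0, l) = (if l = 0 then cnj (\<sigma> g $$ (0, 0)) else 0)" if l: "l < d'" for l
    proof -
      have "(mat_adjoint (\<sigma> g) * M) $$ (0, l) = (\<Sum>k<d. if k = 0 then (if l = 0 then cnj (\<sigma> g $$ (0, 0)) else 0) else 0)"
        unfolding mult_mat_index[OF sg' M d(1) l]
        using d l by (intro sum.cong refl) (auto simp: M_def mat_adjoint_index[OF sg])
      then show ?thesis using d by simp
    qed
    then have "(mat_adjoint (\<sigma> g) * M * \<tau> g) $$ (0, 0) =
        (\<Sum>l<d'. if l = 0 then cnj (\<sigma> g $$ (0, 0)) * \<tau> g $$ (0, 0) else 0)"
      unfolding mult_mat_index[OF mult_carrier_mat[OF sg' M] tg d] by (intro sum.cong refl) auto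
    then show "(mat_adjoint (\<sigma> g) * M * \<tau> g) $$ (0, 0) = cnj (\<sigma> g $$ (0, 0)) * \<tau> g $$ (0, 0)"
      using d by simp
  qed
  finally show ?thesis by simp
qed

text \<open>The \<open>(0, 0)\<close> coefficients are pairwise orthogonal functions on G_e, and
  nonzero because they take the value 1 at \<open>e\<close>.\<close>

lemma inequivalent_unitary_irreps_length_le:
  assumes "inequivalent_unitary_irreps \<sigma>s"
  shows "length \<sigma>s \<le> card (Hgroup e)"
proof (rule orthogonal_family_le_card[where f = "\<lambda>k g. fst (\<sigma>s ! k) g $$ (0, 0)"])
  show "finite (Hgroup e)" by simp
next
  fix k l assume "k < length \<sigma>s" "l < length \<sigma>s" "k \<noteq> l"
  then show "(\<Sum>g\<in>Hgroup e. cnj (fst (\<sigma>s ! k) g $$ (0, 0)) * fst (\<sigma>s ! l) g $$ (0, 0)) = 0"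
    using assms unfolding inequivalent_unitary_irreps_def
    by (intro schur_orthogonality[of "snd (\<sigma>s ! k)" _ "snd (\<sigma>s ! l)"]) auto
next
  fix k assume k: "k < length \<sigma>s"
  let ?\<rho> = "fst (\<sigma>s ! k)" and ?d = "snd (\<sigma>s ! k)"
  have irr: "irreducible_rep e ?d ?\<rho>"
    using assms k by (auto simp: inequivalent_unitary_irreps_def)
  have "?\<rho> e $$ (0, 0) = 1"
    using is_mat_repD(3)[OF irreducible_repD(1)[OF irr]] irreducible_repD(2)[OF irr] by simp
  then have "1 = (cmod (?\<rho> e $$ (0, 0)))\<^sup>2" by simp
  also have "\<dots> \<le> (\<Sum>g\<in>Hgroup e. (cmod (?\<rho> g $$ (0, 0)))\<^sup>2)"
    using e_in_Hgroup by (intro member_le_sum[of e _ "\<lambda>g. (cmod (?\<rho> g $$ (0, 0)))\<^sup>2"]) auto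
  finally have pos: "(\<Sum>g\<in>Hgroup e. (cmod (?\<rho> g $$ (0, 0)))\<^sup>2) \<noteq> 0" by linarith
  have "(\<Sum>g\<in>Hgroup e. cnj (?\<rho> g $$ (0, 0)) * ?\<rho> g $$ (0, 0)) =
      of_real (\<Sum>g\<in>Hgroup e. (cmod (?\<rho> g $$ (0, 0)))\<^sup>2)"
    by (simp only: of_real_sum complex_norm_square mult.commute)
  then show "(\<Sum>g\<in>Hgroup e. cnj (?\<rho> g $$ (0, 0)) * ?\<rho> g $$ (0, 0)) \<noteq> 0"
    using pos by (metis of_real_eq_0_iff)
qed

lemma complete_unitary_irreps_exist:
  obtains \<sigma>s where "complete_irreps e \<sigma>s"
    "\<And>\<rho> d g. (\<rho>, d) \<in> set \<sigma>s \<Longrightarrow> g \<in> Hgroup e \<Longrightarrow> unitary_mat d (\<rho> g)"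
proof -
  have "inequivalent_unitary_irreps []" by (simp add: inequivalent_unitary_irreps_def)
  then obtain \<sigma>s where \<sigma>s: "inequivalent_unitary_irreps \<sigma>s"
    and max: "\<And>\<tau>s. inequivalent_unitary_irreps \<tau>s \<Longrightarrow> length \<tau>s \<le> length \<sigma>s"
    using ex_has_greatest_nat[of inequivalent_unitary_irreps "[]" length "Suc (card (Hgroup e))"]
      inequivalent_unitary_irreps_length_le by (metis le_imp_less_Suc)
  have nth: "irreducible_rep e (snd (\<sigma>s ! k)) (fst (\<sigma>s ! k))"
    "\<And>g. g \<in> Hgroup e \<Longrightarrow> unitary_mat (snd (\<sigma>s ! k)) (fst (\<sigma>s ! k) g)" if "k < length \<sigma>s" for k
    using \<sigma>s that by (auto simp: inequivalent_unitary_irreps_def)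
  have "\<exists>k<length \<sigma>s. equiv_rep e d \<rho> (snd (\<sigma>s ! k)) (fst (\<sigma>s ! k))" if irr: "irreducible_rep e d \<rho>" for d \<rho>
  proof -
    note rep = irreducible_repD(1)[OF irr]
    obtain P Q where P: "P \<in> carrier_mat d d" "Q \<in> carrier_mat d d" "P * Q = 1\<^sub>m d" "Q * P = 1\<^sub>m d"
      and unit: "\<And>g. g \<in> Hgroup e \<Longrightarrow> unitary_mat d (P * \<rho> g * Q)"
      using unitarize[OF rep] by blast
    define \<rho>' where "\<rho>' = (\<lambda>g. P * \<rho> g * Q)"
    have irr': "irreducible_rep e d \<rho>'" and eq: "equiv_rep e d \<rho> d \<rho>'"
      unfolding \<rho>'_def using irreducible_rep_conj[OF irr P] equiv_rep_conj[OF rep P] by auto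
    note rep' = irreducible_repD(1)[OF irr']
    \<comment> \<open>The unitarised representation cannot extend a longest list, so it is
      equivalent to a member.\<close>
    have "\<not> inequivalent_unitary_irreps (\<sigma>s @ [(\<rho>', d)])"
      using max[of "\<sigma>s @ [(\<rho>', d)]"] by auto
    moreover have "inequivalent_unitary_irreps (\<sigma>s @ [(\<rho>', d)])"
      if no: "\<And>k. k < length \<sigma>s \<Longrightarrow> \<not> equiv_rep e d \<rho>' (snd (\<sigma>s ! k)) (fst (\<sigma>s ! k))"
    proof -
      \<comment> \<open>The definition asks for inequivalence in both orders, hence the appeal to
        symmetry.\<close>
      have no': "\<not> equiv_rep e (snd (\<sigma>s ! k)) (fst (\<sigma>s ! k)) d \<rho>'" if "k < length \<sigma>s" for k
        using no[OF that] equiv_rep_sym[OF irreducible_repD(1)[OF nth(1)[OF that]] rep'] by blast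
      show ?thesis
        using \<sigma>s irr' unit no no' unfolding inequivalent_unitary_irreps_def
        by (auto simp: nth_append less_Suc_eq \<rho>'_def[symmetric] fun_cong[OF \<rho>'_def, symmetric])
    qed
    ultimately obtain k where k: "k < length \<sigma>s" "equiv_rep e d \<rho>' (snd (\<sigma>s ! k)) (fst (\<sigma>s ! k))"
      by blast
    then show ?thesis
      using equiv_rep_trans[OF rep rep' irreducible_repD(1)[OF nth(1)[OF k(1)]] eq] by blast
  qed
  then have "complete_irreps e \<sigma>s"
    using \<sigma>s unfolding complete_irreps_def inequivalent_unitary_irreps_def by blast
  moreover have "unitary_mat d (\<rho> g)" if "(\<rho>, d) \<in> set \<sigma>s" "g \<in> Hgroup e" for \<rho> d g
    using nth(2)[OF _ that(2)] that(1) by (metis fst_conv in_set_conv_nth snd_conv)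
  ultimately show ?thesis using that by blast
qed

end

section \<open>Induced and coinduced representations\<close>

context finite_idempotent
begin

lemma L_repsD:
  assumes "L_reps e xs"
  shows "i < length xs \<Longrightarrow> xs ! i \<in> Lclass e"
    and "x \<in> Lclass e \<Longrightarrow> \<exists>i<length xs. \<exists>g\<in>Hgroup e. x = xs ! i * g"
    and "\<lbrakk>i < length xs; j < length xs; g \<in> Hgroup e; h \<in> Hgroup e; xs ! i * g = xs ! j * h\<rbrakk> \<Longrightarrow> i = j"
proof -
  note reps = assms[unfolded L_reps_def]
  show "xs ! i \<in> Lclass e" if "i < length xs"
    using subsetD[OF reps[THEN conjunct1] nth_mem[OF that]] .
  show "\<exists>i<length xs. \<exists>g\<in>Hgroup e. x = xs ! i * g" if "x \<in> Lclass e"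
  proof -
    have "x \<in> (\<Union>i<length xs. (\<lambda>g. xs ! i * g) ` Hgroup e)"
      using that unfolding reps[THEN conjunct2, THEN conjunct1, symmetric] .
    then show ?thesis by auto
  qed
  show "i = j" if ij: "i < length xs" "j < length xs" and gh: "g \<in> Hgroup e" "h \<in> Hgroup e"
    and eq: "xs ! i * g = xs ! j * h"
  proof (rule ccontr)
    assume "i \<noteq> j"
    then have "(\<lambda>g. xs ! i * g) ` Hgroup e \<inter> (\<lambda>g. xs ! j * g) ` Hgroup e = {}"
      using reps[THEN conjunct2, THEN conjunct2] ij by blast
    moreover have "xs ! i * g \<in> (\<lambda>g. xs ! i * g) ` Hgroup e" using gh(1) by blast
    moreover have "xs ! i * g \<in> (\<lambda>g. xs ! j * g) ` Hgroup e" unfolding eq using gh(2) by blast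
    ultimately show False by blast
  qed
qed

lemma R_repsD:
  assumes "R_reps e ys"
  shows "i < length ys \<Longrightarrow> ys ! i \<in> Rclass e"
    and "y \<in> Rclass e \<Longrightarrow> \<exists>i<length ys. \<exists>g\<in>Hgroup e. y = g * ys ! i"
    and "\<lbrakk>i < length ys; j < length ys; g \<in> Hgroup e; h \<in> Hgroup e; g * ys ! i = h * ys ! j\<rbrakk> \<Longrightarrow> i = j"
proof -
  note reps = assms[unfolded R_reps_def]
  show "ys ! i \<in> Rclass e" if "i < length ys"
    using subsetD[OF reps[THEN conjunct1] nth_mem[OF that]] .
  show "\<exists>i<length ys. \<exists>g\<in>Hgroup e. y = g * ys ! i" if "y \<in> Rclass e"
  proof -
    have "y \<in> (\<Union>i<length ys. (\<lambda>g. g * ys ! i) ` Hgroup e)"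
      using that unfolding reps[THEN conjunct2, THEN conjunct1, symmetric] .
    then show ?thesis by auto
  qed
  show "i = j" if ij: "i < length ys" "j < length ys" and gh: "g \<in> Hgroup e" "h \<in> Hgroup e"
    and eq: "g * ys ! i = h * ys ! j"
  proof (rule ccontr)
    assume "i \<noteq> j"
    then have "(\<lambda>g. g * ys ! i) ` Hgroup e \<inter> (\<lambda>g. g * ys ! j) ` Hgroup e = {}"
      using reps[THEN conjunct2, THEN conjunct2] ij by blast
    moreover have "g * ys ! i \<in> (\<lambda>g. g * ys ! i) ` Hgroup e" using gh(1) by blast
    moreover have "g * ys ! i \<in> (\<lambda>g. g * ys ! j) ` Hgroup e" unfolding eq using gh(2) by blast
    ultimately show False by blast
  qed
qed

section \<open>Entries of the two matrix representations\<close>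

lemma Ind_rep_carrier:
  "Ind_rep e xs \<sigma>s u \<in> carrier_mat (length xs * dsum_dim \<sigma>s) (length xs * dsum_dim \<sigma>s)"
  by (simp add: Ind_rep_def Let_def)

lemma Coind_rep_carrier:
  "Coind_rep e ys \<sigma>s u \<in> carrier_mat (length ys * dsum_dim \<sigma>s) (length ys * dsum_dim \<sigma>s)"
  by (simp add: Coind_rep_def Let_def)

text \<open>Any \<open>g\<close> solving the block equation is the one chosen by \<open>THE\<close>,
  by freeness of the action, and the equation itself puts the product in L_e.\<close>

lemma Ind_rep_entry:
  assumes xs: "L_reps e xs" and j: "r div dsum_dim \<sigma>s < length xs" "r < length xs * dsum_dim \<sigma>s"
    and i: "c div dsum_dim \<sigma>s < length xs" "c < length xs * dsum_dim \<sigma>s"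
    and g: "g \<in> Hgroup e" "u * xs ! (c div dsum_dim \<sigma>s) = xs ! (r div dsum_dim \<sigma>s) * g"
  shows "Ind_rep e xs \<sigma>s u $$ (r, c) = dsum_rep \<sigma>s g $$ (r mod dsum_dim \<sigma>s, c mod dsum_dim \<sigma>s)"
proof -
  have "(THE g'. g' \<in> Hgroup e \<and> u * xs ! (c div dsum_dim \<sigma>s) = xs ! (r div dsum_dim \<sigma>s) * g') = g"
    using g Lclass_cancel[OF L_repsD(1)[OF xs j(1)]] by (intro the_equality) auto
  moreover have "u * xs ! (c div dsum_dim \<sigma>s) \<in> Lclass e"
    unfolding g(2) using Lclass_mult_Hgroup[OF L_repsD(1)[OF xs j(1)] g(1)] .
  ultimately show ?thesis
    using i j g by (auto simp: Ind_rep_def Let_def)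
qed

lemma Ind_rep_entry_0:
  assumes "r < length xs * dsum_dim \<sigma>s" "c < length xs * dsum_dim \<sigma>s"
    and "\<And>g. g \<in> Hgroup e \<Longrightarrow> u * xs ! (c div dsum_dim \<sigma>s) \<noteq> xs ! (r div dsum_dim \<sigma>s) * g"
  shows "Ind_rep e xs \<sigma>s u $$ (r, c) = 0"
  using assms by (auto simp: Ind_rep_def Let_def)

lemma Coind_rep_entry:
  assumes ys: "R_reps e ys" and j: "r div dsum_dim \<sigma>s < length ys" "r < length ys * dsum_dim \<sigma>s"
    and i: "c div dsum_dim \<sigma>s < length ys" "c < length ys * dsum_dim \<sigma>s"
    and g: "g \<in> Hgroup e" "ys ! (r div dsum_dim \<sigma>s) * u = g * ys ! (c div dsum_dim \<sigma>s)"
  shows "Coind_rep e ys \<sigma>s u $$ (r, c) = dsum_rep \<sigma>s g $$ (r mod dsum_dim \<sigma>s, c mod dsum_dim \<sigma>s)"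
proof -
  have "(THE h. h \<in> Hgroup e \<and> ys ! (r div dsum_dim \<sigma>s) * u = h * ys ! (c div dsum_dim \<sigma>s)) = g"
    using g Rclass_cancel[OF R_repsD(1)[OF ys i(1)]] by (intro the_equality) auto
  moreover have "ys ! (r div dsum_dim \<sigma>s) * u \<in> Rclass e"
    unfolding g(2) using Hgroup_mult_Rclass[OF R_repsD(1)[OF ys i(1)] g(1)] .
  ultimately show ?thesis
    using i j g by (auto simp: Coind_rep_def Let_def)
qed

lemma Coind_rep_entry_0:
  assumes "r < length ys * dsum_dim \<sigma>s" "c < length ys * dsum_dim \<sigma>s"
    and "\<And>g. g \<in> Hgroup e \<Longrightarrow> ys ! (r div dsum_dim \<sigma>s) * u \<noteq> g * ys ! (c div dsum_dim \<sigma>s)"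
  shows "Coind_rep e ys \<sigma>s u $$ (r, c) = 0"
  using assms by (auto simp: Coind_rep_def Let_def)

text \<open>With \<open>u * u' * u = u\<close> and \<open>e = s * u * x\<close>, both \<open>x\<close> and \<open>u' * u * x\<close> are inverses of \<open>e * s * u\<close>.\<close>

lemma inverse_semigroup_left_cancel:
  assumes inv: "inverse_semigroup TYPE('a)"
    and x: "x \<in> Lclass e" and x': "x' \<in> Lclass e" and ux: "u * x \<in> Lclass e" and eq: "u * x = u * x'"
  shows "x = x'"
proof -
  obtain u' where u': "u * u' * u = u"
    using inv unfolding inverse_semigroup_def by blast
  obtain s where s: "s * (u * x) = e"
    using ux by (auto simp: mem_Lclass_iff[OF idem])
  have stab: "u' * u * z = z" if z: "z \<in> Lclass e" and uz: "u * z = u * x" for z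
  proof -
    let ?t = "e * s * u"
    have ze: "z * e = z" using Lclass_e[OF z] .
    have tz: "?t * z = e"
      by (simp add: mult.assoc uz s ee)
    have tfz: "?t * (u' * u * z) = e"
    proof -
      have "?t * (u' * u * z) = e * s * (u * u' * u) * z" by (simp only: mult.assoc)
      then show ?thesis using tz by (simp only: u')
    qed
    have et: "e * ?t = ?t" by (simp only: mult.assoc[symmetric] ee)
    have "?t * z * ?t = ?t \<and> z * ?t * z = z"
      unfolding mult.assoc[of z] tz ze et by (rule conjI refl)+
    moreover have "?t * (u' * u * z) * ?t = ?t \<and> (u' * u * z) * ?t * (u' * u * z) = u' * u * z"
      unfolding mult.assoc[of "u' * u * z"] tfz et by (simp only: mult.assoc ze simp_thms)
    ultimately show ?thesis
      using inv unfolding inverse_semigroup_def by blast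
  qed
  have "x = u' * (u * x)" using stab[OF x refl] by (simp only: mult.assoc)
  also have "\<dots> = x'" using stab[OF x' eq[symmetric]] by (simp only: mult.assoc eq)
  finally show ?thesis .
qed

text \<open>With \<open>u * u' * u = u\<close> and \<open>y * u * s = e\<close>, both
  \<open>y\<close> and \<open>y * (u * u')\<close> are inverses of \<open>u * s * e\<close>, hence
  equal. The same holds for \<open>y'\<close>, so \<open>y\<close> and \<open>y'\<close> are both
  recovered from \<open>y * u = y' * u\<close>.\<close>

lemma inverse_semigroup_right_cancel:
  assumes inv: "inverse_semigroup TYPE('a)"
    and y: "y \<in> Rclass e" and y': "y' \<in> Rclass e" and yu: "y * u \<in> Rclass e" and eq: "y * u = y' * u"
  shows "y = y'"
proof -
  obtain u' where u': "u * u' * u = u"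
    using inv unfolding inverse_semigroup_def by blast
  obtain s where s: "y * u * s = e"
    using yu by (auto simp: mem_Rclass_iff[OF idem])
  have stab: "z * (u * u') = z" if z: "z \<in> Rclass e" and zu: "z * u = y * u" for z
  proof -
    let ?t = "u * s * e"
    have ez: "e * z = z" using Rclass_e[OF z] .
    have zt: "z * ?t = e"
      by (simp add: mult.assoc[symmetric] zu s ee)
    have zft: "z * (u * u') * ?t = e"
    proof -
      have "z * (u * u') * ?t = z * ((u * u' * u) * s * e)" by (simp only: mult.assoc)
      then show ?thesis using zt by (simp only: u')
    qed
    have te: "?t * e = ?t" by (simp only: mult.assoc ee)
    have "?t * z * ?t = ?t \<and> z * ?t * z = z"
      unfolding mult.assoc[of ?t] zt ez te by (rule conjI refl)+
    moreover have "?t * (z * (u * u')) * ?t = ?t \<and> (z * (u * u')) * ?t * (z * (u * u')) = z * (u * u')"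
      unfolding mult.assoc[of ?t] zft te by (simp only: mult.assoc[symmetric] ez simp_thms)
    ultimately show ?thesis
      using inv unfolding inverse_semigroup_def by blast
  qed
  have "y = y * u * u'" using stab[OF y refl] by (simp only: mult.assoc)
  also have "\<dots> = y'" using stab[OF y' eq[symmetric]] by (simp only: mult.assoc[symmetric] eq)
  finally show ?thesis .
qed

section \<open>Semiunitarity over an inverse semigroup\<close>

text \<open>Each block column has at most one block because the orbits in L_e are disjoint; each
  block row has at most one because \<open>u\<close> can be cancelled.\<close>

lemma Ind_rep_semiunitary:
  assumes inv: "inverse_semigroup TYPE('a)" and xs: "L_reps e xs"
    and unit: "\<And>\<rho> d g. (\<rho>, d) \<in> set \<sigma>s \<Longrightarrow> g \<in> Hgroup e \<Longrightarrow> unitary_mat d (\<rho> g)"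
  shows "semiunitary (Ind_rep e xs \<sigma>s)"
  unfolding semiunitary_def
proof
  fix u
  let ?M = "\<lambda>j i. u * xs ! i \<in> Lclass e \<and> (\<exists>g\<in>Hgroup e. u * xs ! i = xs ! j * g)"
  let ?g = "\<lambda>j i. THE g. g \<in> Hgroup e \<and> u * xs ! i = xs ! j * g"
  show "Ind_rep e xs \<sigma>s u * mat_adjoint (Ind_rep e xs \<sigma>s u) * Ind_rep e xs \<sigma>s u = Ind_rep e xs \<sigma>s u"
  proof (rule partial_monomial_unitary_blocks_semiunitary[where M = ?M and U = "\<lambda>j i. dsum_rep \<sigma>s (?g j i)"])
    show "Ind_rep e xs \<sigma>s u \<in> carrier_mat (length xs * dsum_dim \<sigma>s) (length xs * dsum_dim \<sigma>s)"
      by (rule Ind_rep_carrier)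
  next
    fix r c assume "r < length xs * dsum_dim \<sigma>s" "c < length xs * dsum_dim \<sigma>s"
    then show "Ind_rep e xs \<sigma>s u $$ (r, c) = (if ?M (r div dsum_dim \<sigma>s) (c div dsum_dim \<sigma>s)
        then dsum_rep \<sigma>s (?g (r div dsum_dim \<sigma>s) (c div dsum_dim \<sigma>s)) $$ (r mod dsum_dim \<sigma>s, c mod dsum_dim \<sigma>s) else 0)"
      by (simp add: Ind_rep_def Let_def)
  next
    fix j i assume ji: "j < length xs" "i < length xs" "?M j i"
    then obtain g where g: "g \<in> Hgroup e" "u * xs ! i = xs ! j * g" by blast
    then have "?g j i = g"
      using Lclass_cancel[OF L_repsD(1)[OF xs ji(1)]] by (intro the_equality) auto
    then show "unitary_mat (dsum_dim \<sigma>s) (dsum_rep \<sigma>s (?g j i))"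
      using dsum_rep_unitary unit g(1) by metis
  next
    fix j j' i assume "j < length xs" "j' < length xs" "?M j i" "?M j' i"
    then show "j = j'" using L_repsD(3)[OF xs] by metis
  next
    fix j i i' assume ji: "j < length xs" "i < length xs" "i' < length xs" "?M j i" "?M j i'"
    then obtain g h where g: "g \<in> Hgroup e" "u * xs ! i = xs ! j * g"
      and h: "h \<in> Hgroup e" "u * xs ! i' = xs ! j * h" by blast
    \<comment> \<open>The factor \<open>k * h\<close> corrects \<open>xs ! i\<close> within its
      orbit so that \<open>u\<close> sends it to \<open>u * xs ! i'\<close>; cancelling
      \<open>u\<close> then puts \<open>xs ! i\<close> and \<open>xs ! i'\<close> in one
      orbit.\<close>
    obtain k where k: "k \<in> Hgroup e" "g * k = e" using Hgroup_inverse[OF g(1)] by blast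
    have kh: "k * h \<in> Hgroup e" using Hgroup_mult k h by blast
    have "u * (xs ! i * (k * h)) = (u * xs ! i) * k * h" by (simp only: mult.assoc)
    also have "\<dots> = xs ! j * ((g * k) * h)" unfolding g(2) by (simp only: mult.assoc)
    also have "\<dots> = u * xs ! i'" unfolding k(2) h(2) Hgroup_units(2)[OF h(1)] ..
    finally have eq: "u * (xs ! i * (k * h)) = u * xs ! i'" .
    have "xs ! i * (k * h) = xs ! i'"
      using inverse_semigroup_left_cancel[OF inv _ _ _ eq] ji(5) L_repsD(1)[OF xs] ji
        Lclass_mult_Hgroup[OF _ kh] eq by auto
    then have "xs ! i * (k * h) = xs ! i' * e"
      using Lclass_e[OF L_repsD(1)[OF xs ji(3)]] by simp
    then show "i = i'"
      using L_repsD(3)[OF xs ji(2,3) kh e_in_Hgroup] by blast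
  qed
qed

text \<open>Rows and columns change roles: disjointness of the orbits in R_e now bounds the blocks
  in a row, and right cancellation those in a column.\<close>

lemma Coind_rep_semiunitary:
  assumes inv: "inverse_semigroup TYPE('a)" and ys: "R_reps e ys"
    and unit: "\<And>\<rho> d g. (\<rho>, d) \<in> set \<sigma>s \<Longrightarrow> g \<in> Hgroup e \<Longrightarrow> unitary_mat d (\<rho> g)"
  shows "semiunitary (Coind_rep e ys \<sigma>s)"
  unfolding semiunitary_def
proof
  fix u
  let ?M = "\<lambda>j i. ys ! j * u \<in> Rclass e \<and> (\<exists>h\<in>Hgroup e. ys ! j * u = h * ys ! i)"
  let ?g = "\<lambda>j i. THE h. h \<in> Hgroup e \<and> ys ! j * u = h * ys ! i"
  show "Coind_rep e ys \<sigma>s u * mat_adjoint (Coind_rep e ys \<sigma>s u) * Coind_rep e ys \<sigma>s u = Coind_rep e ys \<sigma>s u"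
  proof (rule partial_monomial_unitary_blocks_semiunitary[where M = ?M and U = "\<lambda>j i. dsum_rep \<sigma>s (?g j i)"])
    show "Coind_rep e ys \<sigma>s u \<in> carrier_mat (length ys * dsum_dim \<sigma>s) (length ys * dsum_dim \<sigma>s)"
      by (rule Coind_rep_carrier)
  next
    fix r c assume "r < length ys * dsum_dim \<sigma>s" "c < length ys * dsum_dim \<sigma>s"
    then show "Coind_rep e ys \<sigma>s u $$ (r, c) = (if ?M (r div dsum_dim \<sigma>s) (c div dsum_dim \<sigma>s)
        then dsum_rep \<sigma>s (?g (r div dsum_dim \<sigma>s) (c div dsum_dim \<sigma>s)) $$ (r mod dsum_dim \<sigma>s, c mod dsum_dim \<sigma>s) else 0)"
      by (simp add: Coind_rep_def Let_def)
  next
    fix j i assume ji: "j < length ys" "i < length ys" "?M j i"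
    then obtain g where g: "g \<in> Hgroup e" "ys ! j * u = g * ys ! i" by blast
    then have "?g j i = g"
      using Rclass_cancel[OF R_repsD(1)[OF ys ji(2)]] by (intro the_equality) auto
    then show "unitary_mat (dsum_dim \<sigma>s) (dsum_rep \<sigma>s (?g j i))"
      using dsum_rep_unitary unit g(1) by metis
  next
    fix j i i' assume "i < length ys" "i' < length ys" "?M j i" "?M j i'"
    then show "i = i'" using R_repsD(3)[OF ys] by metis
  next
    fix j j' i assume ji: "j < length ys" "j' < length ys" "i < length ys" "?M j i" "?M j' i"
    then obtain g h where g: "g \<in> Hgroup e" "ys ! j * u = g * ys ! i"
      and h: "h \<in> Hgroup e" "ys ! j' * u = h * ys ! i" by blast
    obtain k where k: "k \<in> Hgroup e" "k * g = e" using Hgroup_inverse[OF g(1)] by blast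
    have hk: "h * k \<in> Hgroup e" using Hgroup_mult k h by blast
    have "(h * k * ys ! j) * u = h * k * (ys ! j * u)" by (simp only: mult.assoc)
    also have "\<dots> = (h * (k * g)) * ys ! i" unfolding g(2) by (simp only: mult.assoc)
    also have "\<dots> = ys ! j' * u" unfolding k(2) h(2) Hgroup_units(1)[OF h(1)] ..
    finally have eq: "(h * k * ys ! j) * u = ys ! j' * u" .
    have "h * k * ys ! j = ys ! j'"
      using inverse_semigroup_right_cancel[OF inv _ _ _ eq] ji(5) R_repsD(1)[OF ys] ji
        Hgroup_mult_Rclass[OF _ hk] eq by auto
    then have "h * k * ys ! j = e * ys ! j'"
      using Rclass_e[OF R_repsD(1)[OF ys ji(2)]] by simp
    then show "j = j'"
      using R_repsD(3)[OF ys ji(1,2) hk e_in_Hgroup] by blast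
  qed
qed

section \<open>Uniqueness of idempotents from semiunitarity\<close>

lemma complete_irreps_dsum:
  assumes \<sigma>s: "complete_irreps e \<sigma>s"
  shows "g \<in> Hgroup e \<Longrightarrow> dsum_rep \<sigma>s g \<in> carrier_mat (dsum_dim \<sigma>s) (dsum_dim \<sigma>s)"
    and "g \<in> Hgroup e \<Longrightarrow> h \<in> Hgroup e \<Longrightarrow> dsum_rep \<sigma>s (g * h) = dsum_rep \<sigma>s g * dsum_rep \<sigma>s h"
    and "dsum_rep \<sigma>s e = 1\<^sub>m (dsum_dim \<sigma>s)"
    and "dsum_dim \<sigma>s > 0"
proof -
  have irr: "irreducible_rep e d \<rho>" if "(\<rho>, d) \<in> set \<sigma>s" for \<rho> d
    using that \<sigma>s unfolding complete_irreps_def by (metis fst_conv in_set_conv_nth snd_conv)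
  note rep = is_mat_repD[OF irreducible_repD(1)[OF irr]]
  show "dsum_rep \<sigma>s g \<in> carrier_mat (dsum_dim \<sigma>s) (dsum_dim \<sigma>s)" if "g \<in> Hgroup e"
    using rep(1)[OF _ that] by (rule dsum_rep_carrier)
  show "dsum_rep \<sigma>s (g * h) = dsum_rep \<sigma>s g * dsum_rep \<sigma>s h" if "g \<in> Hgroup e" "h \<in> Hgroup e"
    using rep(1)[OF _ that(1)] rep(1)[OF _ that(2)] rep(2)[OF _ that] by (intro dsum_rep_mult) blast
  show "dsum_rep \<sigma>s e = 1\<^sub>m (dsum_dim \<sigma>s)"
    using rep(3) by (rule dsum_rep_one)
  obtain k where k: "k < length \<sigma>s"
    using \<sigma>s trivial_rep_irreducible unfolding complete_irreps_def by blast
  then have "snd (\<sigma>s ! k) > 0"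
    using irreducible_repD(2) \<sigma>s unfolding complete_irreps_def by blast
  moreover have "snd (\<sigma>s ! k) \<in> set (map snd \<sigma>s)" using k by simp
  ultimately show "dsum_dim \<sigma>s > 0"
    unfolding dsum_dim_def using member_le_sum_list[of "snd (\<sigma>s ! k)" "map snd \<sigma>s"] by linarith
qed

text \<open>The matrix of \<open>g\<close> times that of its inverse is the identity, so no row
  vanishes. This detects a nonzero block of the induced matrix by an entry in its first row.\<close>

lemma dsum_rep_row_nonzero:
  assumes \<sigma>s: "complete_irreps e \<sigma>s" and g: "g \<in> Hgroup e"
  obtains b where "b < dsum_dim \<sigma>s" "dsum_rep \<sigma>s g $$ (0, b) \<noteq> 0"
proof -
  note D = complete_irreps_dsum[OF \<sigma>s]
  obtain h where h: "h \<in> Hgroup e" "g * h = e" using Hgroup_inverse[OF g] by blast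
  have "(\<Sum>b<dsum_dim \<sigma>s. dsum_rep \<sigma>s g $$ (0, b) * dsum_rep \<sigma>s h $$ (b, 0)) = (dsum_rep \<sigma>s (g * h)) $$ (0, 0)"
    unfolding D(2)[OF g h(1)] mult_mat_index[OF D(1)[OF g] D(1)[OF h(1)] D(4) D(4)] ..
  also have "\<dots> = 1" unfolding h(2) D(3) using D(4) by simp
  finally have "(\<Sum>b<dsum_dim \<sigma>s. dsum_rep \<sigma>s g $$ (0, b) * dsum_rep \<sigma>s h $$ (b, 0)) \<noteq> 0" by simp
  then obtain b where "b \<in> {..<dsum_dim \<sigma>s}" "dsum_rep \<sigma>s g $$ (0, b) * dsum_rep \<sigma>s h $$ (b, 0) \<noteq> 0"
    by (rule sum.not_neutral_contains_not_neutral)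
  then show ?thesis by (intro that[of b]) auto
qed

lemma dsum_rep_col_nonzero:
  assumes \<sigma>s: "complete_irreps e \<sigma>s" and g: "g \<in> Hgroup e"
  obtains b where "b < dsum_dim \<sigma>s" "dsum_rep \<sigma>s g $$ (b, 0) \<noteq> 0"
proof -
  note D = complete_irreps_dsum[OF \<sigma>s]
  obtain h where h: "h \<in> Hgroup e" "h * g = e" using Hgroup_inverse[OF g] by blast
  have "(\<Sum>b<dsum_dim \<sigma>s. dsum_rep \<sigma>s h $$ (0, b) * dsum_rep \<sigma>s g $$ (b, 0)) = (dsum_rep \<sigma>s (h * g)) $$ (0, 0)"
    unfolding D(2)[OF h(1) g] mult_mat_index[OF D(1)[OF h(1)] D(1)[OF g] D(4) D(4)] ..
  also have "\<dots> = 1" unfolding h(2) D(3) using D(4) by simp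
  finally have "(\<Sum>b<dsum_dim \<sigma>s. dsum_rep \<sigma>s h $$ (0, b) * dsum_rep \<sigma>s g $$ (b, 0)) \<noteq> 0" by simp
  then obtain b where "b \<in> {..<dsum_dim \<sigma>s}" "dsum_rep \<sigma>s h $$ (0, b) * dsum_rep \<sigma>s g $$ (b, 0) \<noteq> 0"
    by (rule sum.not_neutral_contains_not_neutral)
  then show ?thesis by (intro that[of b]) auto
qed

text \<open>The last two hypotheses say that \<open>f\<close> and \<open>f'\<close> are
  L-related.\<close>

lemma semiunitary_Ind_rep_unique_idempotent:
  assumes xs: "L_reps e xs" and \<sigma>s: "complete_irreps e \<sigma>s" and semi: "semiunitary (Ind_rep e xs \<sigma>s)"
    and f: "idempotent f" and f': "idempotent f'" and J: "e \<in> Jclass f"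
    and ff': "f * f' = f" and f'f: "f' * f = f'"
  shows "f = f'"
proof -
  note D = complete_irreps_dsum[OF \<sigma>s]
  let ?D = "dsum_dim \<sigma>s" and ?n = "length xs * dsum_dim \<sigma>s"
  \<comment> \<open>\<open>x\<close> is a common point of R_f and L_e; its orbit representative
    \<open>z\<close> is likewise fixed by \<open>f\<close> on the left.\<close>
  obtain x y where xy: "f * x = x" "x * e = x" "x * y = f" "y * x = e"
    using Jclass_idempotents_factor[OF idem f J] by metis
  have "x \<in> Lclass e" using xy by (auto simp: mem_Lclass_iff[OF idem])
  then obtain i g where i: "i < length xs" and g: "g \<in> Hgroup e" "x = xs ! i * g"
    using L_repsD(2)[OF xs] by blast
  define z where "z = xs ! i"
  have zL: "z \<in> Lclass e" using L_repsD(1)[OF xs i] by (simp add: z_def)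
  have ze: "z * e = z" using Lclass_e[OF zL] .
  obtain k where k: "k \<in> Hgroup e" "g * k = e" using Hgroup_inverse[OF g(1)] by blast
  have z: "z = x * k" unfolding g(2) z_def[symmetric] mult.assoc k(2) ze ..
  have fz: "f * z = z" unfolding z mult.assoc[symmetric] xy(1) ..
  obtain s where s: "s * z = e" using zL by (auto simp: mem_Lclass_iff[OF idem])
  \<comment> \<open>Since \<open>f * f' = f\<close>, the product \<open>f' * z\<close> can still be
    brought back to \<open>e\<close> and stays in L_e.\<close>
  have "(s * f) * (f' * z) = s * ((f * f') * z)" by (simp only: mult.assoc)
  then have "(s * f) * (f' * z) = e" by (simp only: ff' fz s)
  moreover have "(f' * z) * e = f' * z" by (simp only: mult.assoc ze)
  ultimately have "f' * z \<in> Lclass e" by (auto simp: mem_Lclass_iff[OF idem])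
  then obtain l h where l: "l < length xs" and h: "h \<in> Hgroup e" "f' * z = xs ! l * h"
    using L_repsD(2)[OF xs] by blast
  obtain h' where h': "h' \<in> Hgroup e" "h * h' = e" using Hgroup_inverse[OF h(1)] by blast
  have xl: "xs ! l = f' * z * h'"
    unfolding h(2) mult.assoc h'(2) Lclass_e[OF L_repsD(1)[OF xs l]] ..
  have "f * xs ! l = (f * f') * z * h'" unfolding xl by (simp only: mult.assoc)
  then have fxl: "f * xs ! l = xs ! i * h'" by (simp only: ff' fz z_def[symmetric])
  have li: "l = i"
  proof (rule ccontr)
    assume "l \<noteq> i"
    let ?A = "Ind_rep e xs \<sigma>s f"
    note r = block_index[OF i D(4)]
    obtain b where b: "b < ?D" "dsum_rep \<sigma>s h' $$ (0, b) \<noteq> 0"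
      using dsum_rep_row_nonzero[OF \<sigma>s h'(1)] .
    note c = block_index[OF l b(1)]
    \<comment> \<open>As \<open>f\<close> fixes \<open>xs ! i\<close>, block column \<open>i\<close>
      holds only the identity block. Its first column is a unit vector, which forces the row of the
      same index to be one.\<close>
    have "?A $$ (i * ?D + 0, l * ?D + b) = 0"
    proof (rule partial_isometry_unit_col_imp_unit_row[OF Ind_rep_carrier _ r(1) _ c(1)])
      show "?A * mat_adjoint ?A * ?A = ?A" using semi by (simp add: semiunitary_def)
      show "l * ?D + b \<noteq> i * ?D + 0" using c(2) r(2) \<open>l \<noteq> i\<close> by metis
      fix m assume m: "m < ?n"
      have md: "m div ?D < length xs" using m by (simp add: less_mult_imp_div_less)
      show "?A $$ (m, i * ?D + 0) = (if m = i * ?D + 0 then 1 else 0)"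
      proof (cases "m div ?D = i")
        case True
        have "?A $$ (m, i * ?D + 0) = dsum_rep \<sigma>s e $$ (m mod ?D, 0)"
          using Ind_rep_entry[OF xs md m _ r(1) e_in_Hgroup, of f] True i r fz ze by (simp add: z_def)
        moreover have "m = i * ?D + m mod ?D" using True by (metis div_mult_mod_eq)
        then have "m = i * ?D + 0 \<longleftrightarrow> m mod ?D = 0" by linarith
        ultimately show ?thesis using D(3,4) by simp
      next
        case False
        have "f * xs ! i \<noteq> xs ! (m div ?D) * g'" if "g' \<in> Hgroup e" for g'
        proof
          assume "f * xs ! i = xs ! (m div ?D) * g'"
          then have "xs ! i * e = xs ! (m div ?D) * g'" using fz ze by (simp add: z_def)
          then show False using L_repsD(3)[OF xs i md e_in_Hgroup that] False by blast
        qed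
        then have "?A $$ (m, i * ?D + 0) = 0"
          by (intro Ind_rep_entry_0[OF m r(1)]) (unfold r(2))
        then show ?thesis using False r(2) by metis
      qed
    qed
    moreover have "?A $$ (i * ?D + 0, l * ?D + b) = dsum_rep \<sigma>s h' $$ (0, b)"
      using Ind_rep_entry[OF xs _ r(1) _ c(1) h'(1), of f] r(2,3) c(2,3) i l fxl by simp
    ultimately show False using b(2) by simp
  qed
  \<comment> \<open>With \<open>l = i\<close>, \<open>z\<close> is a left multiple by the idempotent
    \<open>f'\<close>, hence fixed by it.\<close>
  have zf: "z = f' * z * h'" using xl li by (simp add: z_def)
  have "f' * z = f' * (f' * z * h')" using zf by simp
  also have "\<dots> = (f' * f') * z * h'" by (simp only: mult.assoc)
  also have "\<dots> = z" using f' zf by (simp add: idempotent_def)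
  finally have f'z: "f' * z = z" .
  have "f' * f = (f' * z) * g * y"
    unfolding xy(3)[symmetric] g(2) z_def[symmetric] by (simp only: mult.assoc)
  also have "\<dots> = f" unfolding f'z xy(3)[symmetric] g(2) z_def[symmetric] ..
  finally show ?thesis using f'f by simp
qed

text \<open>The last two hypotheses say that \<open>f\<close> and \<open>f'\<close> are R-related.
  Here \<open>f\<close> fixes \<open>ys ! i\<close> on the right, so block row \<open>i\<close>
  holds only the identity block, and a unit row forces a unit column.\<close>

lemma semiunitary_Coind_rep_unique_idempotent:
  assumes ys: "R_reps e ys" and \<sigma>s: "complete_irreps e \<sigma>s" and semi: "semiunitary (Coind_rep e ys \<sigma>s)"
    and f: "idempotent f" and f': "idempotent f'" and J: "e \<in> Jclass f"
    and ff': "f * f' = f'" and f'f: "f' * f = f"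
  shows "f = f'"
proof -
  note D = complete_irreps_dsum[OF \<sigma>s]
  let ?D = "dsum_dim \<sigma>s" and ?n = "length ys * dsum_dim \<sigma>s"
  obtain x y where xy: "e * y = y" "y * f = y" "x * y = f" "y * x = e"
    using Jclass_idempotents_factor[OF idem f J] by metis
  have "y \<in> Rclass e" using xy by (auto simp: mem_Rclass_iff[OF idem])
  then obtain i g where i: "i < length ys" and g: "g \<in> Hgroup e" "y = g * ys ! i"
    using R_repsD(2)[OF ys] by blast
  define z where "z = ys ! i"
  have zR: "z \<in> Rclass e" using R_repsD(1)[OF ys i] by (simp add: z_def)
  have ez: "e * z = z" using Rclass_e[OF zR] .
  obtain k where k: "k \<in> Hgroup e" "k * g = e" using Hgroup_inverse[OF g(1)] by blast
  have z: "z = k * y" unfolding g(2) z_def[symmetric] mult.assoc[symmetric] k(2) ez ..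
  have zf: "z * f = z" unfolding z mult.assoc xy(2) ..
  obtain s where s: "z * s = e" using zR by (auto simp: mem_Rclass_iff[OF idem])
  have "(z * f') * (f * s) = z * (f' * f) * s" by (simp only: mult.assoc)
  then have "(z * f') * (f * s) = e" by (simp only: f'f zf s)
  moreover have "e * (z * f') = z * f'" by (simp only: mult.assoc[symmetric] ez)
  ultimately have "z * f' \<in> Rclass e" by (auto simp: mem_Rclass_iff[OF idem])
  then obtain l h where l: "l < length ys" and h: "h \<in> Hgroup e" "z * f' = h * ys ! l"
    using R_repsD(2)[OF ys] by blast
  obtain h' where h': "h' \<in> Hgroup e" "h' * h = e" using Hgroup_inverse[OF h(1)] by blast
  have yl: "ys ! l = h' * (z * f')"
    unfolding h(2) mult.assoc[symmetric] h'(2) Rclass_e[OF R_repsD(1)[OF ys l]] ..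
  have "ys ! l * f = h' * (z * (f' * f))" unfolding yl by (simp only: mult.assoc)
  then have ylf: "ys ! l * f = h' * ys ! i" by (simp only: f'f zf z_def[symmetric])
  have li: "l = i"
  proof (rule ccontr)
    assume "l \<noteq> i"
    let ?A = "Coind_rep e ys \<sigma>s f"
    note r = block_index[OF i D(4)]
    obtain b where b: "b < ?D" "dsum_rep \<sigma>s h' $$ (b, 0) \<noteq> 0"
      using dsum_rep_col_nonzero[OF \<sigma>s h'(1)] .
    note c = block_index[OF l b(1)]
    have "?A $$ (l * ?D + b, i * ?D + 0) = 0"
    proof (rule partial_isometry_unit_row_imp_unit_col[OF Coind_rep_carrier _ r(1) _ c(1)])
      show "?A * mat_adjoint ?A * ?A = ?A" using semi by (simp add: semiunitary_def)
      show "l * ?D + b \<noteq> i * ?D + 0" using c(2) r(2) \<open>l \<noteq> i\<close> by metis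
      fix m assume m: "m < ?n"
      have md: "m div ?D < length ys" using m by (simp add: less_mult_imp_div_less)
      show "?A $$ (i * ?D + 0, m) = (if m = i * ?D + 0 then 1 else 0)"
      proof (cases "m div ?D = i")
        case True
        have "?A $$ (i * ?D + 0, m) = dsum_rep \<sigma>s e $$ (0, m mod ?D)"
          using Coind_rep_entry[OF ys _ r(1) md m e_in_Hgroup, of f] True i r zf ez by (simp add: z_def)
        moreover have "m = i * ?D + m mod ?D" using True by (metis div_mult_mod_eq)
        then have "m = i * ?D + 0 \<longleftrightarrow> m mod ?D = 0" by linarith
        ultimately show ?thesis using D(3,4) by simp
      next
        case False
        have "ys ! i * f \<noteq> g' * ys ! (m div ?D)" if "g' \<in> Hgroup e" for g'
        proof
          assume "ys ! i * f = g' * ys ! (m div ?D)"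
          then have "e * ys ! i = g' * ys ! (m div ?D)" using zf ez by (simp add: z_def)
          then show False using R_repsD(3)[OF ys i md e_in_Hgroup that] False by blast
        qed
        then have "?A $$ (i * ?D + 0, m) = 0"
          by (intro Coind_rep_entry_0[OF r(1) m]) (unfold r(2))
        then show ?thesis using False r(2) by metis
      qed
    qed
    moreover have "?A $$ (l * ?D + b, i * ?D + 0) = dsum_rep \<sigma>s h' $$ (b, 0)"
      using Coind_rep_entry[OF ys _ c(1) _ r(1) h'(1), of f] r(2,3) c(2,3) i l ylf by simp
    ultimately show False using b(2) by simp
  qed
  have zf': "z = h' * (z * f')" using yl li by (simp add: z_def)
  have "z * f' = h' * (z * f') * f'" using zf' by simp
  also have "\<dots> = h' * (z * (f' * f'))" by (simp only: mult.assoc)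
  also have "\<dots> = z" using f' zf' by (simp add: idempotent_def)
  finally have f'z: "z * f' = z" .
  have "f * f' = x * (g * (z * f'))"
    unfolding xy(3)[symmetric] g(2) z_def[symmetric] by (simp only: mult.assoc)
  also have "\<dots> = f" unfolding f'z xy(3)[symmetric] g(2) z_def[symmetric] ..
  finally show ?thesis using ff' by simp
qed

end

section \<open>The two implications\<close>

lemma inverse_semigroup_has_semiunitary_schutz_pair:
  fixes a :: "'a::{finite,semigroup_mult}"
  assumes inv: "inverse_semigroup TYPE('a)"
  shows "has_semiunitary_schutz_pair a"
proof -
  obtain b where b: "a * b * a = a"
    using inv unfolding inverse_semigroup_def by blast
  have idem: "idempotent (a * b)"
    unfolding idempotent_def mult.assoc[symmetric] b ..
  interpret finite_idempotent "a * b" using idem by unfold_locales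
  obtain xs ys where xs: "L_reps (a * b) xs" and ys: "R_reps (a * b) ys"
    using L_reps_exist R_reps_exist by blast
  obtain \<sigma>s where \<sigma>s: "complete_irreps (a * b) \<sigma>s"
    "\<And>\<rho> d g. (\<rho>, d) \<in> set \<sigma>s \<Longrightarrow> g \<in> Hgroup (a * b) \<Longrightarrow> unitary_mat d (\<rho> g)"
    using complete_unitary_irreps_exist by blast
  have "semiunitary (Ind_rep (a * b) xs \<sigma>s)" "semiunitary (Coind_rep (a * b) ys \<sigma>s)"
    using \<sigma>s(2) by (auto intro!: Ind_rep_semiunitary[OF inv xs] Coind_rep_semiunitary[OF inv ys])
  then show ?thesis
    unfolding has_semiunitary_schutz_pair_def
    using Jclass_mult_inverse[OF b] idem xs ys \<sigma>s(1) by blast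
qed

text \<open>The first alternative, L-relatedness, is settled by the induced representation; the
  second, R-relatedness, by the coinduced one.\<close>

lemma has_semiunitary_schutz_pair_unique_idempotent:
  fixes f f' :: "'a::{finite,semigroup_mult}"
  assumes "has_semiunitary_schutz_pair f" "f * f = f" "f' * f' = f'"
    and "f * f' = f \<and> f' * f = f' \<or> f * f' = f' \<and> f' * f = f"
  shows "f = f'"
proof -
  obtain e xs ys \<sigma>s where e: "e \<in> Jclass f" "idempotent e"
    and pair: "L_reps e xs" "R_reps e ys" "complete_irreps e \<sigma>s"
      "semiunitary (Ind_rep e xs \<sigma>s)" "semiunitary (Coind_rep e ys \<sigma>s)"
    using assms(1) unfolding has_semiunitary_schutz_pair_def by blast
  interpret finite_idempotent e using e(2) by unfold_locales
  have "idempotent f" "idempotent f'" using assms(2,3) by (auto simp: idempotent_def)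
  then show ?thesis
    using semiunitary_Ind_rep_unique_idempotent[OF pair(1,3,4) _ _ e(1)]
      semiunitary_Coind_rep_unique_idempotent[OF pair(2,3,5) _ _ e(1)] assms(4) by blast
qed

theorem mainTheorem13:
  assumes "regular_semigroup TYPE('a::{finite, semigroup_mult})"
  shows "inverse_semigroup TYPE('a) \<longleftrightarrow> (\<forall>a::'a. has_semiunitary_schutz_pair a)"
proof
  assume "inverse_semigroup TYPE('a)"
  then show "\<forall>a::'a. has_semiunitary_schutz_pair a"
    using inverse_semigroup_has_semiunitary_schutz_pair by blast
next
  assume "\<forall>a::'a. has_semiunitary_schutz_pair a"
  then have uniq: "f = f'"
    if "f * f = f" "f' * f' = f'" "f * f' = f \<and> f' * f = f' \<or> f * f' = f' \<and> f' * f = f" for f f' :: 'a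
    using has_semiunitary_schutz_pair_unique_idempotent that by blast
  show "inverse_semigroup TYPE('a)"
    unfolding inverse_semigroup_def
  proof
    fix a :: 'a
    obtain b where b: "a * b * a = a"
      using assms unfolding regular_semigroup_def by blast
    \<comment> \<open>From \<open>a * b * a = a\<close> the element \<open>b * a * b\<close> is an
      inverse of \<open>a\<close>.\<close>
    have "a * (b * a * b) * a = (a * b * a) * b * a" "(b * a * b) * a * (b * a * b) = b * (a * b * a) * b * a * b"
      by (simp_all only: mult.assoc)
    then have ex: "a * (b * a * b) * a = a \<and> (b * a * b) * a * (b * a * b) = b * a * b"
      unfolding b by (simp only: mult.assoc b[unfolded mult.assoc] simp_thms)
    have "c = c'" if c: "a * c * a = a \<and> c * a * c = c" and c': "a * c' * a = a \<and> c' * a * c' = c'" for c c'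
    proof -
      have R: "(a * x) * (a * y) = a * y" "(y * a) * (x * a) = y * a" if "a * x * a = a" for x y
        by (simp_all only: mult.assoc[symmetric] that) (simp only: mult.assoc that[unfolded mult.assoc])
      \<comment> \<open>\<open>a * c\<close> and \<open>a * c'\<close> are R-related idempotents,
        and \<open>c * a\<close> and \<open>c' * a\<close> are L-related ones.\<close>
      have ac: "a * c = a * c'"
        by (rule uniq) (simp_all only: R c c' simp_thms)
      have ca: "c * a = c' * a"
        by (rule uniq) (simp_all only: R c c' simp_thms)
      have "c = c * (a * c)" using c by (simp only: mult.assoc)
      also have "\<dots> = (c * a) * c'" by (simp only: ac mult.assoc)
      also have "\<dots> = c'" by (simp only: ca c')
      finally show ?thesis .
    qed
    with ex show "\<exists>!c. a * c * a = a \<and> c * a * c = c" by blast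
  qed
qed

end
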